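(* Let $R$ and $S$ be unital $2$-torsion free rings, let $M$ be a unital $2$-torsion free $(R,S)$-bimodule which is faithful as a left $R$-module and faithful as a right $S$-module, and let $T=\mathrm{Tri}(R,M,S)$ be the associated triangular ring, with identity $\mathbf{1}$ and centre $Z(T)$. Let $\tau:T\to T$ be an additive map. Then the following conditions are equivalent: (i) There exists a derivation $d:T\to T$ such that $\tau(X)=d(X)+X\tau(\mathbf{1})$ for each $X\in T$, and $\tau(\mathbf{1})\in Z(T)$. (ii) For all $X,Y\in T$, $XY=YX=0$ implies $X\tau(Y)+\tau(X)Y+Y\tau(X)+\tau(Y)X=0$. (iii) $\tau$ is a Jordan generalized derivation via a Jordan derivation $\delta$; that is, there exists a Jordan derivation $\delta:T\to T$ such that $\tau(XY+YX)=X\tau(Y)+\delta(X)Y+\tau(Y)X+Y\delta(X)$ for all $X,Y\in T$. (iv) There is an additive map $\delta:T\to T$ such that for all $X,Y\in T$, $XY=YX=0$ implies $X\delta(Y)+\delta(X)Y+Y\delta(X)+\delta(Y)X=0$, and for all $X,Y\in T$, $XY=YX=0$ implies $X\tau(Y)+\delta(X)Y+Y\delta(X)+\tau(Y)X=0$.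
   Context: All rings are associative. The triangular ring $\mathrm{Tri}(R,M,S)$ is the ring of all matrices $\begin{pmatrix} r & m\\ 0 & s\end{pmatrix}$ with $r\in R$, $m\in M$, $s\in S$, under the usual matrix operations. A ring or module is $2$-torsion free if $2x=0$ implies $x=0$. An additive map $d$ on a ring $A$ is a derivation if $d(xy)=d(x)y+xd(y)$ for all $x,y\in A$. An additive map $\delta$ on $A$ is a Jordan derivation if $\delta(xy+yx)=\delta(x)y+x\delta(y)+\delta(y)x+y\delta(x)$ for all $x,y\in A$. *)

theory Defs
  imports "HOL-Algebra.Module"
begin

(* Rings are unital, and not necessarily commutative or nontrivial, as in HOL-Algebra.
   The left action of a bimodule is the smult field inherited from the module record; the
   inherited mult and one fields of M are never used. The library locale module is not
   applicable, because it requires a commutative scalar ring. *)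

record ('r, 'm, 's) bimodule = "('r, 'm) module" +
  rsmult :: "['m, 's] \<Rightarrow> 'm" (infixl \<open>\<star>\<index>\<close> 70)

locale bimodule = R?: ring R + M?: abelian_group M + S?: ring S
  for R :: "('r, 'x) ring_scheme" (structure)
    and M :: "('r, 'm, 's, 'y) bimodule_scheme" (structure)
    and S :: "('s, 'z) ring_scheme" (structure) +
  assumes lsmult_closed:
      "\<lbrakk>r \<in> carrier R; m \<in> carrier M\<rbrakk> \<Longrightarrow> r \<odot>\<^bsub>M\<^esub> m \<in> carrier M"
    and lsmult_add_scalar:
      "\<lbrakk>r \<in> carrier R; r' \<in> carrier R; m \<in> carrier M\<rbrakk> \<Longrightarrow>
        (r \<oplus>\<^bsub>R\<^esub> r') \<odot>\<^bsub>M\<^esub> m = (r \<odot>\<^bsub>M\<^esub> m) \<oplus>\<^bsub>M\<^esub> (r' \<odot>\<^bsub>M\<^esub> m)"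
    and lsmult_add:
      "\<lbrakk>r \<in> carrier R; m \<in> carrier M; m' \<in> carrier M\<rbrakk> \<Longrightarrow>
        r \<odot>\<^bsub>M\<^esub> (m \<oplus>\<^bsub>M\<^esub> m') = (r \<odot>\<^bsub>M\<^esub> m) \<oplus>\<^bsub>M\<^esub> (r \<odot>\<^bsub>M\<^esub> m')"
    and lsmult_assoc:
      "\<lbrakk>r \<in> carrier R; r' \<in> carrier R; m \<in> carrier M\<rbrakk> \<Longrightarrow>
        (r \<otimes>\<^bsub>R\<^esub> r') \<odot>\<^bsub>M\<^esub> m = r \<odot>\<^bsub>M\<^esub> (r' \<odot>\<^bsub>M\<^esub> m)"
    and lsmult_one:
      "m \<in> carrier M \<Longrightarrow> \<one>\<^bsub>R\<^esub> \<odot>\<^bsub>M\<^esub> m = m"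
    and rsmult_closed:
      "\<lbrakk>m \<in> carrier M; s \<in> carrier S\<rbrakk> \<Longrightarrow> m \<star>\<^bsub>M\<^esub> s \<in> carrier M"
    and rsmult_add_scalar:
      "\<lbrakk>m \<in> carrier M; s \<in> carrier S; s' \<in> carrier S\<rbrakk> \<Longrightarrow>
        m \<star>\<^bsub>M\<^esub> (s \<oplus>\<^bsub>S\<^esub> s') = (m \<star>\<^bsub>M\<^esub> s) \<oplus>\<^bsub>M\<^esub> (m \<star>\<^bsub>M\<^esub> s')"
    and rsmult_add:
      "\<lbrakk>m \<in> carrier M; m' \<in> carrier M; s \<in> carrier S\<rbrakk> \<Longrightarrow>
        (m \<oplus>\<^bsub>M\<^esub> m') \<star>\<^bsub>M\<^esub> s = (m \<star>\<^bsub>M\<^esub> s) \<oplus>\<^bsub>M\<^esub> (m' \<star>\<^bsub>M\<^esub> s)"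
    and rsmult_assoc:
      "\<lbrakk>m \<in> carrier M; s \<in> carrier S; s' \<in> carrier S\<rbrakk> \<Longrightarrow>
        m \<star>\<^bsub>M\<^esub> (s \<otimes>\<^bsub>S\<^esub> s') = (m \<star>\<^bsub>M\<^esub> s) \<star>\<^bsub>M\<^esub> s'"
    and rsmult_one:
      "m \<in> carrier M \<Longrightarrow> m \<star>\<^bsub>M\<^esub> \<one>\<^bsub>S\<^esub> = m"
    and lsmult_rsmult_assoc:
      "\<lbrakk>r \<in> carrier R; m \<in> carrier M; s \<in> carrier S\<rbrakk> \<Longrightarrow>
        (r \<odot>\<^bsub>M\<^esub> m) \<star>\<^bsub>M\<^esub> s = r \<odot>\<^bsub>M\<^esub> (m \<star>\<^bsub>M\<^esub> s)"

definition two_torsion_free :: "('a, 'b) ring_scheme \<Rightarrow> bool" where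
  "two_torsion_free G \<longleftrightarrow> (\<forall>x\<in>carrier G. x \<oplus>\<^bsub>G\<^esub> x = \<zero>\<^bsub>G\<^esub> \<longrightarrow> x = \<zero>\<^bsub>G\<^esub>)"

definition left_faithful ::
  "('r, 'x) ring_scheme \<Rightarrow> ('r, 'm, 's, 'y) bimodule_scheme \<Rightarrow> bool" where
  "left_faithful R M \<longleftrightarrow>
    (\<forall>r\<in>carrier R. (\<forall>m\<in>carrier M. r \<odot>\<^bsub>M\<^esub> m = \<zero>\<^bsub>M\<^esub>) \<longrightarrow> r = \<zero>\<^bsub>R\<^esub>)"

definition right_faithful ::
  "('r, 'm, 's, 'y) bimodule_scheme \<Rightarrow> ('s, 'z) ring_scheme \<Rightarrow> bool" where
  "right_faithful M S \<longleftrightarrow>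
    (\<forall>s\<in>carrier S. (\<forall>m\<in>carrier M. m \<star>\<^bsub>M\<^esub> s = \<zero>\<^bsub>M\<^esub>) \<longrightarrow> s = \<zero>\<^bsub>S\<^esub>)"

(* The triple (r, m, s) stands for the matrix with rows (r, m) and (0, s). *)
definition Tri ::
  "('r, 'x) ring_scheme \<Rightarrow> ('r, 'm, 's, 'y) bimodule_scheme \<Rightarrow> ('s, 'z) ring_scheme
    \<Rightarrow> ('r \<times> 'm \<times> 's) ring" where
  "Tri R M S =
    \<lparr>carrier = carrier R \<times> carrier M \<times> carrier S,
     monoid.mult = (\<lambda>(r, m, s) (r', m', s').
       (r \<otimes>\<^bsub>R\<^esub> r', (r \<odot>\<^bsub>M\<^esub> m') \<oplus>\<^bsub>M\<^esub> (m \<star>\<^bsub>M\<^esub> s'), s \<otimes>\<^bsub>S\<^esub> s')),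
     one = (\<one>\<^bsub>R\<^esub>, \<zero>\<^bsub>M\<^esub>, \<one>\<^bsub>S\<^esub>),
     zero = (\<zero>\<^bsub>R\<^esub>, \<zero>\<^bsub>M\<^esub>, \<zero>\<^bsub>S\<^esub>),
     add = (\<lambda>(r, m, s) (r', m', s'). (r \<oplus>\<^bsub>R\<^esub> r', m \<oplus>\<^bsub>M\<^esub> m', s \<oplus>\<^bsub>S\<^esub> s'))\<rparr>"

definition ring_center :: "('a, 'b) ring_scheme \<Rightarrow> 'a set" where
  "ring_center A = {z \<in> carrier A. \<forall>x\<in>carrier A. z \<otimes>\<^bsub>A\<^esub> x = x \<otimes>\<^bsub>A\<^esub> z}"

definition additive_map :: "('a, 'b) ring_scheme \<Rightarrow> ('a \<Rightarrow> 'a) \<Rightarrow> bool" where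
  "additive_map A f \<longleftrightarrow> f \<in> hom (add_monoid A) (add_monoid A)"

definition derivation :: "('a, 'b) ring_scheme \<Rightarrow> ('a \<Rightarrow> 'a) \<Rightarrow> bool" where
  "derivation A d \<longleftrightarrow> additive_map A d \<and>
    (\<forall>x\<in>carrier A. \<forall>y\<in>carrier A.
      d (x \<otimes>\<^bsub>A\<^esub> y) = (d x \<otimes>\<^bsub>A\<^esub> y) \<oplus>\<^bsub>A\<^esub> (x \<otimes>\<^bsub>A\<^esub> d y))"

definition jordan_derivation :: "('a, 'b) ring_scheme \<Rightarrow> ('a \<Rightarrow> 'a) \<Rightarrow> bool" where
  "jordan_derivation A \<delta> \<longleftrightarrow> additive_map A \<delta> \<and>
    (\<forall>x\<in>carrier A. \<forall>y\<in>carrier A.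
      \<delta> (x \<otimes>\<^bsub>A\<^esub> y \<oplus>\<^bsub>A\<^esub> y \<otimes>\<^bsub>A\<^esub> x) =
        \<delta> x \<otimes>\<^bsub>A\<^esub> y \<oplus>\<^bsub>A\<^esub> x \<otimes>\<^bsub>A\<^esub> \<delta> y \<oplus>\<^bsub>A\<^esub> \<delta> y \<otimes>\<^bsub>A\<^esub> x \<oplus>\<^bsub>A\<^esub> y \<otimes>\<^bsub>A\<^esub> \<delta> x)"

lemma (in bimodule) lsmult_zero:
  assumes r: "r \<in> carrier R" shows "r \<odot>\<^bsub>M\<^esub> \<zero>\<^bsub>M\<^esub> = \<zero>\<^bsub>M\<^esub>"
proof -
  have c: "r \<odot>\<^bsub>M\<^esub> \<zero>\<^bsub>M\<^esub> \<in> carrier M" using r by (simp add: lsmult_closed)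
  have "r \<odot>\<^bsub>M\<^esub> \<zero>\<^bsub>M\<^esub> \<oplus>\<^bsub>M\<^esub> r \<odot>\<^bsub>M\<^esub> \<zero>\<^bsub>M\<^esub> = r \<odot>\<^bsub>M\<^esub> \<zero>\<^bsub>M\<^esub>"
    using lsmult_add[OF r, of "\<zero>\<^bsub>M\<^esub>" "\<zero>\<^bsub>M\<^esub>"] by simp
  then show ?thesis using c by (metis M.add.r_cancel_one')
qed

lemma (in bimodule) rsmult_zero:
  assumes s: "s \<in> carrier S" shows "\<zero>\<^bsub>M\<^esub> \<star>\<^bsub>M\<^esub> s = \<zero>\<^bsub>M\<^esub>"
proof -
  have c: "\<zero>\<^bsub>M\<^esub> \<star>\<^bsub>M\<^esub> s \<in> carrier M" using s by (simp add: rsmult_closed)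
  have "\<zero>\<^bsub>M\<^esub> \<star>\<^bsub>M\<^esub> s \<oplus>\<^bsub>M\<^esub> \<zero>\<^bsub>M\<^esub> \<star>\<^bsub>M\<^esub> s = \<zero>\<^bsub>M\<^esub> \<star>\<^bsub>M\<^esub> s"
    using rsmult_add[of "\<zero>\<^bsub>M\<^esub>" "\<zero>\<^bsub>M\<^esub>", OF _ _ s] by simp
  then show ?thesis using c by (metis M.add.r_cancel_one')
qed

lemma (in bimodule) Tri_ring: "ring (Tri R M S)"
proof (rule ringI)
  show "abelian_group (Tri R M S)"
  proof (rule abelian_groupI)
    fix x assume "x \<in> carrier (Tri R M S)"
    then obtain r m s where x: "x = (r, m, s)" "r \<in> carrier R" "m \<in> carrier M" "s \<in> carrier S"
      by (auto simp: Tri_def)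
    then show "\<exists>y\<in>carrier (Tri R M S). y \<oplus>\<^bsub>Tri R M S\<^esub> x = \<zero>\<^bsub>Tri R M S\<^esub>"
      by (intro bexI[of _ "(\<ominus>\<^bsub>R\<^esub> r, \<ominus>\<^bsub>M\<^esub> m, \<ominus>\<^bsub>S\<^esub> s)"])
         (auto simp: Tri_def R.l_neg M.l_neg S.l_neg)
  qed (auto simp: Tri_def R.a_ac M.a_ac S.a_ac)
  show "monoid (Tri R M S)"
    by (rule monoidI)
      (auto simp: Tri_def R.m_assoc S.m_assoc M.a_assoc lsmult_closed rsmult_closed
        lsmult_add rsmult_add lsmult_assoc rsmult_assoc lsmult_rsmult_assoc
        lsmult_one rsmult_one lsmult_zero rsmult_zero)
qed (auto simp: Tri_def R.l_distr R.r_distr S.l_distr S.r_distr M.a_ac lsmult_closed rsmult_closed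
      lsmult_add rsmult_add lsmult_add_scalar rsmult_add_scalar)

end

theory Submission
  imports Defs
begin

text \<open>
  Conditions (ii) and (iii) are special cases of (iv), and (i) implies all of them by direct
  computation, so the point is to derive (i) from (iv). First let \<open>f\<close> satisfy the zero product
  condition with both maps equal to \<open>f\<close>. Applied to \<open>P\<close> and \<open>1 - P\<close> for an idempotent \<open>P\<close>, it shows
  that \<open>f 1\<close> commutes with every idempotent; the idempotents with rows \<open>(1, m)\<close> and \<open>(0, 0)\<close>
  together with faithfulness then make \<open>f 1\<close> central. Subtracting \<open>X f(1)\<close> one may assume
  \<open>f 1 = 0\<close>, and a few pairs of matrices with zero products determine the entries of \<open>f\<close> well
  enough to see that \<open>f\<close> is a derivation. Finally, \<open>\<phi> = \<tau> - \<delta>\<close> satisfies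
  \<open>X \<phi>(Y) + \<phi>(Y) X = 0\<close> whenever \<open>XY = YX = 0\<close>. By the first part \<open>\<phi>\<close> is a derivation plus
  multiplication by a central element, and that derivation kills all idempotents, hence vanishes.
\<close>

section \<open>Cancellation identities in abelian groups\<close>

context abelian_group
begin

lemma eq_if_diff_zero:
  assumes "x \<ominus> y = \<zero>" "x \<in> carrier G" "y \<in> carrier G"
  shows "x = y"
  using minus_equality[of x "\<ominus> y"] assms by (simp add: a_minus_def)

lemma a_inv_zero: "\<ominus> \<zero> = \<zero>"
  by (rule minus_equality) simp_all

text \<open>This and the next two identities have the shape of corner entries met in
  \<open>zero_product_jordan_derivation\<close>. The term that drops out in each of them
  (\<open>b\<close>, \<open>b\<close> and \<open>p\<close>) is a multiple of the element
  \<open>n\<close> fixed there.\<close>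

lemma add_diff_cancel_left:
  assumes "a \<in> carrier G" "b \<in> carrier G" "c \<in> carrier G" "e \<in> carrier G"
  shows "(a \<ominus> b) \<oplus> (c \<oplus> (b \<ominus> e)) = (c \<oplus> a) \<ominus> e"
proof -
  have "(a \<ominus> b) \<oplus> (c \<oplus> (b \<ominus> e)) = (b \<oplus> \<ominus> b) \<oplus> ((c \<oplus> a) \<ominus> e)"
    using assms by (simp add: a_minus_def a_ac)
  then show ?thesis using assms by (simp add: r_neg)
qed

lemma add_diff_cancel_right:
  assumes "a \<in> carrier G" "b \<in> carrier G" "c \<in> carrier G" "e \<in> carrier G"
  shows "((\<ominus> e \<ominus> b) \<oplus> c) \<oplus> (b \<oplus> a) = (a \<oplus> c) \<ominus> e"
proof -
  have "((\<ominus> e \<ominus> b) \<oplus> c) \<oplus> (b \<oplus> a) = (b \<oplus> \<ominus> b) \<oplus> ((a \<oplus> c) \<ominus> e)"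
    using assms by (simp add: a_minus_def a_ac)
  then show ?thesis using assms by (simp add: r_neg)
qed

lemma add_diff_cancel_middle:
  assumes "a \<in> carrier G" "b \<in> carrier G" "c \<in> carrier G" "e \<in> carrier G"
    "p \<in> carrier G" "q \<in> carrier G" "t \<in> carrier G"
  shows "(a \<oplus> ((p \<oplus> c) \<ominus> t)) \<oplus> (((q \<oplus> b) \<ominus> p) \<oplus> e) = (q \<oplus> ((a \<oplus> b) \<oplus> (c \<oplus> e))) \<ominus> t"
proof -
  have "(a \<oplus> ((p \<oplus> c) \<ominus> t)) \<oplus> (((q \<oplus> b) \<ominus> p) \<oplus> e)
      = (p \<oplus> \<ominus> p) \<oplus> ((q \<oplus> ((a \<oplus> b) \<oplus> (c \<oplus> e))) \<ominus> t)"
    using assms by (simp add: a_minus_def a_ac)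
  then show ?thesis using assms by (simp add: r_neg)
qed

end

section \<open>Additive maps on a ring\<close>

lemma (in ring) additive_map_closed:
  "\<lbrakk>additive_map R f; x \<in> carrier R\<rbrakk> \<Longrightarrow> f x \<in> carrier R"
  by (auto simp: additive_map_def hom_def)

lemma (in ring) additive_map_add:
  "\<lbrakk>additive_map R f; x \<in> carrier R; y \<in> carrier R\<rbrakk> \<Longrightarrow> f (x \<oplus> y) = f x \<oplus> f y"
  by (auto simp: additive_map_def hom_def)

lemma (in ring) additive_map_zero:
  assumes "additive_map R f" shows "f \<zero> = \<zero>"
proof -
  have "f \<zero> \<oplus> f \<zero> = f \<zero>"
    using additive_map_add[OF assms, of \<zero> \<zero>] by simp
  then show ?thesis
    using additive_map_closed[OF assms] by (metis add.r_cancel_one' zero_closed)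
qed

lemma (in ring) additive_map_minus:
  assumes "additive_map R f" "x \<in> carrier R" shows "f (\<ominus> x) = \<ominus> f x"
proof -
  have "f (\<ominus> x) \<oplus> f x = \<zero>"
    using additive_map_add[OF assms(1), of "\<ominus> x" x] assms additive_map_zero[OF assms(1)] by (simp add: l_neg)
  then show ?thesis
    using additive_map_closed[OF assms(1)] assms(2) by (metis minus_equality a_inv_closed)
qed

lemma (in ring) additive_map_diff:
  assumes "additive_map R f" "additive_map R g"
  shows "additive_map R (\<lambda>x. f x \<ominus> g x)"
  unfolding additive_map_def
proof (rule homI)
  fix x y assume "x \<in> carrier (add_monoid R)" "y \<in> carrier (add_monoid R)"
  then have c: "x \<in> carrier R" "y \<in> carrier R" by auto
  have "f x \<oplus> f y \<ominus> (g x \<oplus> g y) = (f x \<ominus> g x) \<oplus> (f y \<ominus> g y)"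
    using c assms[THEN additive_map_closed] by algebra
  then show "f (x \<otimes>\<^bsub>add_monoid R\<^esub> y) \<ominus> g (x \<otimes>\<^bsub>add_monoid R\<^esub> y) = (f x \<ominus> g x) \<otimes>\<^bsub>add_monoid R\<^esub> (f y \<ominus> g y)"
    using c assms by (simp add: additive_map_add)
qed (use assms additive_map_closed in auto)

lemma (in ring) additive_map_mult_right:
  assumes "c \<in> carrier R" shows "additive_map R (\<lambda>x. x \<otimes> c)"
  using assms by (auto simp: additive_map_def hom_def l_distr)

section \<open>The zero product condition in an arbitrary ring\<close>

text \<open>Two maps are allowed so that one notion covers (ii) as the pair (\<tau>, \<tau>), both
  halves of (iv) as (\<delta>, \<delta>) and (\<delta>, \<tau>), and the difference of the two
  halves as (0, \<tau> - \<delta>). The order of the summands is that of (ii) and (iv), so these can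
  be folded into it.\<close>

definition zero_product_jordan :: "('a, 'b) ring_scheme \<Rightarrow> ('a \<Rightarrow> 'a) \<Rightarrow> ('a \<Rightarrow> 'a) \<Rightarrow> bool" where
  "zero_product_jordan A f g \<longleftrightarrow>
    (\<forall>x\<in>carrier A. \<forall>y\<in>carrier A. x \<otimes>\<^bsub>A\<^esub> y = \<zero>\<^bsub>A\<^esub> \<and> y \<otimes>\<^bsub>A\<^esub> x = \<zero>\<^bsub>A\<^esub> \<longrightarrow>
      x \<otimes>\<^bsub>A\<^esub> g y \<oplus>\<^bsub>A\<^esub> f x \<otimes>\<^bsub>A\<^esub> y \<oplus>\<^bsub>A\<^esub> y \<otimes>\<^bsub>A\<^esub> f x \<oplus>\<^bsub>A\<^esub> g y \<otimes>\<^bsub>A\<^esub> x = \<zero>\<^bsub>A\<^esub>)"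

lemma zero_product_jordanD:
  "\<lbrakk>zero_product_jordan A f g; x \<in> carrier A; y \<in> carrier A; x \<otimes>\<^bsub>A\<^esub> y = \<zero>\<^bsub>A\<^esub>; y \<otimes>\<^bsub>A\<^esub> x = \<zero>\<^bsub>A\<^esub>\<rbrakk> \<Longrightarrow>
      x \<otimes>\<^bsub>A\<^esub> g y \<oplus>\<^bsub>A\<^esub> f x \<otimes>\<^bsub>A\<^esub> y \<oplus>\<^bsub>A\<^esub> y \<otimes>\<^bsub>A\<^esub> f x \<oplus>\<^bsub>A\<^esub> g y \<otimes>\<^bsub>A\<^esub> x = \<zero>\<^bsub>A\<^esub>"
  by (simp add: zero_product_jordan_def)

context ring
begin

text \<open>With \<open>q = 1 - p\<close>, the condition for the pair \<open>p\<close>,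
  \<open>q\<close> shows that the two off-diagonal Peirce components of \<open>f 1\<close>, namely
  \<open>p f(1) q\<close> and \<open>q f(1) p\<close>, vanish. Hence both \<open>f(1) p\<close> and
  \<open>p f(1)\<close> equal \<open>p f(1) p\<close>.\<close>

lemma zero_product_jordan_one_commutes_idempotent:
  assumes f: "additive_map R f" and z: "zero_product_jordan R f f"
    and p: "p \<in> carrier R" "p \<otimes> p = p"
  shows "f \<one> \<otimes> p = p \<otimes> f \<one>"
proof -
  define q where "q = \<one> \<ominus> p"
  have q: "q \<in> carrier R" "q \<oplus> p = \<one>" using p unfolding q_def by (simp, algebra)
  have pq: "p \<otimes> q = \<zero>" "q \<otimes> p = \<zero>"
    using p by (auto simp: q_def minus_eq r_distr l_distr r_minus l_minus r_neg)
  have fc: "f p \<in> carrier R" "f q \<in> carrier R" using p q f additive_map_closed by auto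
  have f1: "f \<one> = f q \<oplus> f p" using additive_map_add[OF f q(1) p(1)] q by simp
  have e: "p \<otimes> f q \<oplus> f p \<otimes> q \<oplus> q \<otimes> f p \<oplus> f q \<otimes> p = \<zero>"
    using zero_product_jordanD[OF z p(1) q(1) pq] .
  have qq: "q \<otimes> q = q" using r_distr[OF q(1) p(1) q(1)] pq p(1) q by (simp add: a_comm)
  have 1: "p \<otimes> f \<one> \<otimes> q = \<zero>"
  proof -
    \<comment> \<open>The right-hand side is relation \<open>e\<close> multiplied by
      \<open>p\<close> on the left and \<open>q\<close> on the right. Its last two summands contain
      \<open>p \<otimes> q\<close> and vanish, and the first two add up to
      \<open>p f(1) q\<close>.\<close>
    have "p \<otimes> f \<one> \<otimes> q = (p \<otimes> p) \<otimes> f q \<otimes> q \<oplus> p \<otimes> f p \<otimes> (q \<otimes> q) \<oplus> (p \<otimes> q) \<otimes> f p \<otimes> q \<oplus> p \<otimes> f q \<otimes> (p \<otimes> q)"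
      unfolding p(2) qq pq f1 using p(1) q(1) fc by (simp add: l_distr r_distr m_assoc)
    also have "\<dots> = p \<otimes> (p \<otimes> f q \<oplus> f p \<otimes> q \<oplus> q \<otimes> f p \<oplus> f q \<otimes> p) \<otimes> q"
      using p(1) q(1) fc by (simp add: l_distr r_distr m_assoc)
    finally show ?thesis using e p q by simp
  qed
  have 2: "q \<otimes> f \<one> \<otimes> p = \<zero>"
  proof -
    have "q \<otimes> f \<one> \<otimes> p = (q \<otimes> p) \<otimes> f q \<otimes> p \<oplus> q \<otimes> f p \<otimes> (q \<otimes> p) \<oplus> (q \<otimes> q) \<otimes> f p \<otimes> p \<oplus> q \<otimes> f q \<otimes> (p \<otimes> p)"
      unfolding p(2) qq pq f1 using p(1) q(1) fc by (simp add: l_distr r_distr m_assoc a_comm)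
    also have "\<dots> = q \<otimes> (p \<otimes> f q \<oplus> f p \<otimes> q \<oplus> q \<otimes> f p \<oplus> f q \<otimes> p) \<otimes> p"
      using p(1) q(1) fc by (simp add: l_distr r_distr m_assoc)
    finally show ?thesis using e p q by simp
  qed
  have c: "f \<one> \<in> carrier R" using f additive_map_closed by auto
  have "f \<one> \<otimes> p = (q \<oplus> p) \<otimes> f \<one> \<otimes> p" using q c p by simp
  also have "\<dots> = p \<otimes> f \<one> \<otimes> p" using q(1) c p(1) 2 by (simp add: l_distr)
  also have "\<dots> = p \<otimes> f \<one> \<otimes> (q \<oplus> p)" using q(1) c p(1) 1 by (simp add: r_distr)
  also have "\<dots> = p \<otimes> f \<one>" using q c p by simp
  finally show ?thesis .
qed

text \<open>The condition is linear in the pair of maps, so known solutions can be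
  subtracted.\<close>

lemma zero_product_jordan_diff:
  assumes "additive_map R f" "additive_map R g" "additive_map R f'" "additive_map R g'"
    and z: "zero_product_jordan R f g" "zero_product_jordan R f' g'"
  shows "zero_product_jordan R (\<lambda>x. f x \<ominus> f' x) (\<lambda>x. g x \<ominus> g' x)"
  unfolding zero_product_jordan_def
proof (intro ballI impI)
  fix x y assume c: "x \<in> carrier R" "y \<in> carrier R" and xy: "x \<otimes> y = \<zero> \<and> y \<otimes> x = \<zero>"
  have fg: "f x \<in> carrier R" "g y \<in> carrier R" "f' x \<in> carrier R" "g' y \<in> carrier R"
    using c assms(1-4)[THEN additive_map_closed] by auto
  have minus_add_minus: "(a \<ominus> a') \<oplus> (b \<ominus> b') = (a \<oplus> b) \<ominus> (a' \<oplus> b')"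
    if "a \<in> carrier R" "a' \<in> carrier R" "b \<in> carrier R" "b' \<in> carrier R" for a a' b b'
    using that by algebra
  have "x \<otimes> (g y \<ominus> g' y) \<oplus> (f x \<ominus> f' x) \<otimes> y \<oplus> y \<otimes> (f x \<ominus> f' x) \<oplus> (g y \<ominus> g' y) \<otimes> x
   = (x \<otimes> g y \<ominus> x \<otimes> g' y) \<oplus> (f x \<otimes> y \<ominus> f' x \<otimes> y) \<oplus> (y \<otimes> f x \<ominus> y \<otimes> f' x) \<oplus> (g y \<otimes> x \<ominus> g' y \<otimes> x)"
    using c fg by (simp add: minus_eq l_distr r_distr l_minus r_minus)
  also have "\<dots> = (x \<otimes> g y \<oplus> f x \<otimes> y \<oplus> y \<otimes> f x \<oplus> g y \<otimes> x) \<ominus> (x \<otimes> g' y \<oplus> f' x \<otimes> y \<oplus> y \<otimes> f' x \<oplus> g' y \<otimes> x)"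
    using c fg by (simp add: minus_add_minus)
  also have "\<dots> = \<zero>" using zero_product_jordanD[OF z(1) c] zero_product_jordanD[OF z(2) c] xy by (simp add: minus_eq)
  finally show "x \<otimes> (g y \<ominus> g' y) \<oplus> (f x \<ominus> f' x) \<otimes> y \<oplus> y \<otimes> (f x \<ominus> f' x) \<oplus> (g y \<ominus> g' y) \<otimes> x = \<zero>" .
qed

text \<open>A central factor can be moved to the far right, so each summand vanishes by itself. This
  is why the first map may equally well be zero.\<close>

lemma zero_product_jordan_mult_center:
  assumes "c \<in> ring_center R"
  shows "zero_product_jordan R (\<lambda>x. x \<otimes> c) (\<lambda>x. x \<otimes> c)" "zero_product_jordan R (\<lambda>_. \<zero>) (\<lambda>x. x \<otimes> c)"
proof -
  have c: "c \<in> carrier R" "\<And>x. x \<in> carrier R \<Longrightarrow> c \<otimes> x = x \<otimes> c"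
    using assms by (auto simp: ring_center_def)
  have k: "x \<otimes> (y \<otimes> c) = \<zero>" "y \<otimes> c \<otimes> x = \<zero>"
    if "x \<in> carrier R" "y \<in> carrier R" "x \<otimes> y = \<zero>" "y \<otimes> x = \<zero>" for x y
    using that c by (metis m_assoc l_null)+
  show "zero_product_jordan R (\<lambda>x. x \<otimes> c) (\<lambda>x. x \<otimes> c)" "zero_product_jordan R (\<lambda>_. \<zero>) (\<lambda>x. x \<otimes> c)"
    using k by (auto simp: zero_product_jordan_def)
qed

text \<open>The condition \<open>xy = yx = 0\<close> is symmetric in \<open>x\<close> and
  \<open>y\<close>; the claim is the sum of the two instances of the hypothesis.\<close>

lemma zero_product_jordan_zero_left:
  assumes g: "additive_map R g" and z: "zero_product_jordan R (\<lambda>_. \<zero>) g"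
  shows "zero_product_jordan R g g"
  unfolding zero_product_jordan_def
proof (intro ballI impI)
  fix x y assume c: "x \<in> carrier R" "y \<in> carrier R" and xy: "x \<otimes> y = \<zero> \<and> y \<otimes> x = \<zero>"
  have d: "g x \<in> carrier R" "g y \<in> carrier R" using c g additive_map_closed by auto
  have "x \<otimes> g y \<oplus> g y \<otimes> x = \<zero>" "y \<otimes> g x \<oplus> g x \<otimes> y = \<zero>"
    using zero_product_jordanD[OF z c] zero_product_jordanD[OF z c(2,1)] xy c d by auto
  moreover have "x \<otimes> g y \<oplus> g x \<otimes> y \<oplus> y \<otimes> g x \<oplus> g y \<otimes> x
    = (x \<otimes> g y \<oplus> g y \<otimes> x) \<oplus> (y \<otimes> g x \<oplus> g x \<otimes> y)"
    using c d by algebra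
  ultimately show "x \<otimes> g y \<oplus> g x \<otimes> y \<oplus> y \<otimes> g x \<oplus> g y \<otimes> x = \<zero>" by simp
qed

text \<open>The zero product condition for \<open>1 - p\<close> and \<open>p\<close> says that twice
  \<open>d p\<close> equals \<open>d(p) p + p d(p)\<close>. The derivation rule for
  \<open>p = pp\<close> says that this sum is \<open>d p\<close>.\<close>

lemma zero_product_jordan_derivation_idempotent:
  assumes d: "derivation R d" and z: "zero_product_jordan R (\<lambda>_. \<zero>) d"
    and p: "p \<in> carrier R" "p \<otimes> p = p"
  shows "d p = \<zero>"
proof -
  define q where "q = \<one> \<ominus> p"
  have q: "q \<in> carrier R" using p unfolding q_def by simp
  have pq: "p \<otimes> q = \<zero>" "q \<otimes> p = \<zero>"
    using p by (auto simp: q_def minus_eq r_distr l_distr r_minus l_minus r_neg)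
  have dc: "d p \<in> carrier R" using d p additive_map_closed by (auto simp: derivation_def)
  have e: "q \<otimes> d p \<oplus> d p \<otimes> q = \<zero>"
    using zero_product_jordanD[OF z q p(1)] pq p q dc by simp
  have "d p = d p \<oplus> d p \<ominus> (d p \<otimes> p \<oplus> p \<otimes> d p)"
    using d p dc by (metis derivation_def minus_eq a_assoc r_neg r_zero a_inv_closed)
  also have "\<dots> = q \<otimes> d p \<oplus> d p \<otimes> q" unfolding q_def using p(1) dc by (simp add: minus_eq l_distr r_distr l_minus r_minus minus_add a_ac)
  finally show ?thesis using e by simp
qed

text \<open>The identity of (iii) with \<delta> equal to the derivation of (i). Since
  \<open>c\<close> is central, \<open>(yx)c = (yc)x\<close>, and the two terms with \<open>c\<close>
  are absorbed into the two occurrences of \<open>t y\<close>.\<close>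

lemma derivation_plus_central_jordan:
  assumes d: "derivation R d" and c: "c \<in> ring_center R"
    and t: "\<And>x. x \<in> carrier R \<Longrightarrow> t x = d x \<oplus> x \<otimes> c"
    and xy: "x \<in> carrier R" "y \<in> carrier R"
  shows "t (x \<otimes> y \<oplus> y \<otimes> x) = x \<otimes> t y \<oplus> d x \<otimes> y \<oplus> t y \<otimes> x \<oplus> y \<otimes> d x"
proof -
  have a: "additive_map R d" using d by (simp add: derivation_def)
  have dc: "d x \<in> carrier R" "d y \<in> carrier R" using additive_map_closed[OF a] xy by auto
  have cc: "c \<in> carrier R" "y \<otimes> c \<otimes> x = y \<otimes> x \<otimes> c"
    using c xy by (auto simp: ring_center_def m_assoc)
  have "t (x \<otimes> y \<oplus> y \<otimes> x) = (d x \<otimes> y \<oplus> x \<otimes> d y \<oplus> (d y \<otimes> x \<oplus> y \<otimes> d x)) \<oplus> (x \<otimes> y \<otimes> c \<oplus> y \<otimes> c \<otimes> x)"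
    using d xy cc by (simp add: t additive_map_add[OF a] derivation_def l_distr)
  also have "\<dots> = x \<otimes> t y \<oplus> d x \<otimes> y \<oplus> t y \<otimes> x \<oplus> y \<otimes> d x"
    using xy dc cc(1) by (simp add: t[OF xy(2)] l_distr r_distr m_assoc a_ac)
  finally show ?thesis .
qed

lemma derivation_jordan_derivation:
  assumes d: "derivation R d" shows "jordan_derivation R d"
  unfolding jordan_derivation_def
proof (intro conjI ballI)
  show a: "additive_map R d" using d by (simp add: derivation_def)
  fix x y assume c: "x \<in> carrier R" "y \<in> carrier R"
  then have dc: "d x \<in> carrier R" "d y \<in> carrier R" using additive_map_closed[OF a] by auto
  show "d (x \<otimes> y \<oplus> y \<otimes> x) = d x \<otimes> y \<oplus> x \<otimes> d y \<oplus> d y \<otimes> x \<oplus> y \<otimes> d x"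
    using d c dc by (simp add: additive_map_add[OF a] derivation_def a_assoc)
qed

lemma jordan_derivation_zero_product_jordan:
  assumes d: "jordan_derivation R d" shows "zero_product_jordan R d d"
  unfolding zero_product_jordan_def
proof (intro ballI impI)
  fix x y assume c: "x \<in> carrier R" "y \<in> carrier R" and xy: "x \<otimes> y = \<zero> \<and> y \<otimes> x = \<zero>"
  have a: "additive_map R d" using d by (simp add: jordan_derivation_def)
  have dc: "d x \<in> carrier R" "d y \<in> carrier R" using additive_map_closed[OF a] c by auto
  have "d x \<otimes> y \<oplus> x \<otimes> d y \<oplus> d y \<otimes> x \<oplus> y \<otimes> d x = d (x \<otimes> y \<oplus> y \<otimes> x)"
    using d c by (simp add: jordan_derivation_def)
  also have "\<dots> = \<zero>" using xy additive_map_zero[OF a] by simp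
  finally show "x \<otimes> d y \<oplus> d x \<otimes> y \<oplus> y \<otimes> d x \<oplus> d y \<otimes> x = \<zero>"
    using c dc by (simp add: a_ac)
qed

text \<open>If both products vanish, the left-hand side of the Jordan identity is
  \<open>t 0 = 0\<close>. Together with the preceding lemma this leads from (iii) to (iv).\<close>

lemma jordan_generalized_zero_product_jordan:
  assumes a: "additive_map R d" and t: "additive_map R t"
    and eq: "\<And>x y. \<lbrakk>x \<in> carrier R; y \<in> carrier R\<rbrakk> \<Longrightarrow>
      t (x \<otimes> y \<oplus> y \<otimes> x) = x \<otimes> t y \<oplus> d x \<otimes> y \<oplus> t y \<otimes> x \<oplus> y \<otimes> d x"
  shows "zero_product_jordan R d t"
  unfolding zero_product_jordan_def
proof (intro ballI impI)
  fix x y assume c: "x \<in> carrier R" "y \<in> carrier R" and xy: "x \<otimes> y = \<zero> \<and> y \<otimes> x = \<zero>"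
  have dc: "d x \<in> carrier R" "t y \<in> carrier R"
    using additive_map_closed[OF a] additive_map_closed[OF t] c by auto
  have "x \<otimes> t y \<oplus> d x \<otimes> y \<oplus> t y \<otimes> x \<oplus> y \<otimes> d x = \<zero>"
    using eq[OF c] xy additive_map_zero[OF t] by simp
  then show "x \<otimes> t y \<oplus> d x \<otimes> y \<oplus> y \<otimes> d x \<oplus> t y \<otimes> x = \<zero>"
    using c dc by (simp add: a_ac)
qed

text \<open>When \<open>xy = yx = 0\<close>, the central summand of \<open>t x\<close> is
  annihilated by \<open>y\<close> on both sides, so \<open>t x\<close> and \<open>d x\<close> have
  the same products with \<open>y\<close>. The condition for the pair (\<open>d\<close>,
  \<open>t\<close>) thus becomes that for (\<open>t\<close>, \<open>t\<close>).\<close>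

lemma derivation_plus_central_zero_product_jordan:
  assumes d: "derivation R d" and c: "c \<in> ring_center R" and a: "additive_map R t"
    and t: "\<And>x. x \<in> carrier R \<Longrightarrow> t x = d x \<oplus> x \<otimes> c"
  shows "zero_product_jordan R t t"
  unfolding zero_product_jordan_def
proof (intro ballI impI)
  fix x y assume xy: "x \<in> carrier R" "y \<in> carrier R" and z: "x \<otimes> y = \<zero> \<and> y \<otimes> x = \<zero>"
  have ad: "additive_map R d" using d by (simp add: derivation_def)
  have dc: "d x \<in> carrier R" "t y \<in> carrier R"
    using additive_map_closed[OF ad] additive_map_closed[OF a] xy by auto
  have cc: "c \<in> carrier R" using c by (simp add: ring_center_def)
  have "x \<otimes> c \<otimes> y = x \<otimes> y \<otimes> c" "y \<otimes> (x \<otimes> c) = y \<otimes> x \<otimes> c"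
    using c xy by (auto simp: ring_center_def m_assoc)
  then have "t x \<otimes> y = d x \<otimes> y" "y \<otimes> t x = y \<otimes> d x"
    using z xy dc cc by (simp_all add: t l_distr r_distr)
  then show "x \<otimes> t y \<oplus> t x \<otimes> y \<oplus> y \<otimes> t x \<oplus> t y \<otimes> x = \<zero>"
    using jordan_generalized_zero_product_jordan[OF ad a derivation_plus_central_jordan[OF d c t]]
      z xy by (simp add: zero_product_jordan_def)
qed

lemma mult_diff_add:
  assumes "x \<in> carrier R" "a \<in> carrier R" "b \<in> carrier R" "c \<in> carrier R"
  shows "x \<otimes> (a \<ominus> b) \<oplus> c = (c \<ominus> x \<otimes> b) \<oplus> x \<otimes> a"
  using assms by (simp add: minus_eq r_distr r_minus a_ac)

end

section \<open>Bimodule arithmetic and entrywise computation in the triangular ring\<close>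

context bimodule
begin

lemma lsmult_minus:
  assumes "r \<in> carrier R" "m \<in> carrier M"
  shows "r \<odot>\<^bsub>M\<^esub> (\<ominus>\<^bsub>M\<^esub> m) = \<ominus>\<^bsub>M\<^esub> (r \<odot>\<^bsub>M\<^esub> m)"
  using lsmult_add[of r "\<ominus>\<^bsub>M\<^esub> m" m] assms
  by (simp add: M.l_neg lsmult_zero lsmult_closed M.minus_equality)

lemma rsmult_minus:
  assumes "m \<in> carrier M" "s \<in> carrier S"
  shows "(\<ominus>\<^bsub>M\<^esub> m) \<star>\<^bsub>M\<^esub> s = \<ominus>\<^bsub>M\<^esub> (m \<star>\<^bsub>M\<^esub> s)"
  using rsmult_add[of "\<ominus>\<^bsub>M\<^esub> m" m s] assms
  by (simp add: M.l_neg rsmult_zero rsmult_closed M.minus_equality)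

lemma lsmult_zero_scalar:
  assumes "m \<in> carrier M" shows "\<zero>\<^bsub>R\<^esub> \<odot>\<^bsub>M\<^esub> m = \<zero>\<^bsub>M\<^esub>"
  using lsmult_add_scalar[of "\<zero>\<^bsub>R\<^esub>" "\<zero>\<^bsub>R\<^esub>" m] assms lsmult_closed[of "\<zero>\<^bsub>R\<^esub>" m]
  by (metis M.add.r_cancel_one' R.zero_closed R.l_zero)

lemma rsmult_zero_scalar:
  assumes "m \<in> carrier M" shows "m \<star>\<^bsub>M\<^esub> \<zero>\<^bsub>S\<^esub> = \<zero>\<^bsub>M\<^esub>"
  using rsmult_add_scalar[of m "\<zero>\<^bsub>S\<^esub>" "\<zero>\<^bsub>S\<^esub>"] assms rsmult_closed[of m "\<zero>\<^bsub>S\<^esub>"]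
  by (metis M.add.r_cancel_one' S.zero_closed S.l_zero)

lemma lsmult_minus_scalar:
  assumes "r \<in> carrier R" "m \<in> carrier M"
  shows "(\<ominus>\<^bsub>R\<^esub> r) \<odot>\<^bsub>M\<^esub> m = \<ominus>\<^bsub>M\<^esub> (r \<odot>\<^bsub>M\<^esub> m)"
  using lsmult_add_scalar[of "\<ominus>\<^bsub>R\<^esub> r" r m] assms
  by (simp add: R.l_neg lsmult_zero_scalar lsmult_closed M.minus_equality)

lemma rsmult_minus_scalar:
  assumes "m \<in> carrier M" "s \<in> carrier S"
  shows "m \<star>\<^bsub>M\<^esub> (\<ominus>\<^bsub>S\<^esub> s) = \<ominus>\<^bsub>M\<^esub> (m \<star>\<^bsub>M\<^esub> s)"
  using rsmult_add_scalar[of m "\<ominus>\<^bsub>S\<^esub> s" s] assms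
  by (simp add: S.l_neg rsmult_zero_scalar rsmult_closed M.minus_equality)

lemmas smult_simps =
  lsmult_closed lsmult_add_scalar lsmult_add lsmult_assoc lsmult_one lsmult_zero lsmult_minus
  lsmult_zero_scalar lsmult_minus_scalar rsmult_closed rsmult_add_scalar rsmult_add
  rsmult_assoc rsmult_one rsmult_zero rsmult_minus rsmult_zero_scalar rsmult_minus_scalar
  lsmult_rsmult_assoc

lemma lsmult_diff:
  assumes "r \<in> carrier R" "m \<in> carrier M" "m' \<in> carrier M"
  shows "r \<odot>\<^bsub>M\<^esub> (m \<ominus>\<^bsub>M\<^esub> m') = r \<odot>\<^bsub>M\<^esub> m \<ominus>\<^bsub>M\<^esub> r \<odot>\<^bsub>M\<^esub> m'"
  using assms by (simp add: M.minus_eq smult_simps)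

lemma rsmult_diff:
  assumes "m \<in> carrier M" "m' \<in> carrier M" "s \<in> carrier S"
  shows "(m \<ominus>\<^bsub>M\<^esub> m') \<star>\<^bsub>M\<^esub> s = m \<star>\<^bsub>M\<^esub> s \<ominus>\<^bsub>M\<^esub> m' \<star>\<^bsub>M\<^esub> s"
  using assms by (simp add: M.minus_eq smult_simps)

lemma Tri_carrier_iff:
  "(r, m, s) \<in> carrier (Tri R M S) \<longleftrightarrow> r \<in> carrier R \<and> m \<in> carrier M \<and> s \<in> carrier S"
  by (auto simp: Tri_def)

lemma Tri_carrierE:
  assumes "x \<in> carrier (Tri R M S)"
  obtains r m s where "x = (r, m, s)" "r \<in> carrier R" "m \<in> carrier M" "s \<in> carrier S"
  using assms by (auto simp: Tri_def)

lemma Tri_mult: "(r, m, s) \<otimes>\<^bsub>Tri R M S\<^esub> (r', m', s') =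
    (r \<otimes>\<^bsub>R\<^esub> r', (r \<odot>\<^bsub>M\<^esub> m') \<oplus>\<^bsub>M\<^esub> (m \<star>\<^bsub>M\<^esub> s'), s \<otimes>\<^bsub>S\<^esub> s')"
  by (simp add: Tri_def)

lemma Tri_add: "(r, m, s) \<oplus>\<^bsub>Tri R M S\<^esub> (r', m', s') = (r \<oplus>\<^bsub>R\<^esub> r', m \<oplus>\<^bsub>M\<^esub> m', s \<oplus>\<^bsub>S\<^esub> s')"
  by (simp add: Tri_def)

lemma Tri_zero: "\<zero>\<^bsub>Tri R M S\<^esub> = (\<zero>\<^bsub>R\<^esub>, \<zero>\<^bsub>M\<^esub>, \<zero>\<^bsub>S\<^esub>)"
  by (simp add: Tri_def)

lemma Tri_one: "\<one>\<^bsub>Tri R M S\<^esub> = (\<one>\<^bsub>R\<^esub>, \<zero>\<^bsub>M\<^esub>, \<one>\<^bsub>S\<^esub>)"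
  by (simp add: Tri_def)

lemmas Tri_simps = Tri_carrier_iff Tri_mult Tri_add Tri_zero Tri_one

lemma Tri_minus:
  assumes "r \<in> carrier R" "m \<in> carrier M" "s \<in> carrier S"
  shows "\<ominus>\<^bsub>Tri R M S\<^esub> (r, m, s) = (\<ominus>\<^bsub>R\<^esub> r, \<ominus>\<^bsub>M\<^esub> m, \<ominus>\<^bsub>S\<^esub> s)"
proof -
  interpret T: ring "Tri R M S" by (rule Tri_ring)
  show ?thesis
    using assms by (intro T.minus_equality) (auto simp: Tri_simps R.l_neg M.l_neg S.l_neg)
qed

end

section \<open>Centre and derivations of the triangular ring of a faithful bimodule\<close>

locale faithful_bimodule = bimodule R M S
  for R :: "('r, 'x) ring_scheme" (structure)
    and M :: "('r, 'm, 's, 'y) bimodule_scheme" (structure)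
    and S :: "('s, 'z) ring_scheme" (structure) +
  assumes left_faithful: "left_faithful R M" and right_faithful: "right_faithful M S"

sublocale bimodule \<subseteq> T: ring "Tri R M S"
  by (rule Tri_ring)

context faithful_bimodule
begin

abbreviation T :: "('r \<times> 'm \<times> 's) ring" where "T \<equiv> Tri R M S"

lemma left_faithful_eq:
  assumes "r \<in> carrier R" "r' \<in> carrier R"
    and "\<And>m. m \<in> carrier M \<Longrightarrow> r \<odot>\<^bsub>M\<^esub> m = r' \<odot>\<^bsub>M\<^esub> m"
  shows "r = r'"
proof -
  have "(r \<ominus>\<^bsub>R\<^esub> r') \<odot>\<^bsub>M\<^esub> m = \<zero>\<^bsub>M\<^esub>" if "m \<in> carrier M" for m
    using assms that by (simp add: R.minus_eq smult_simps M.r_neg)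
  then have "r \<ominus>\<^bsub>R\<^esub> r' = \<zero>\<^bsub>R\<^esub>"
    using left_faithful assms by (simp add: left_faithful_def)
  then show ?thesis using assms(1,2) by (rule R.eq_if_diff_zero)
qed

lemma right_faithful_eq:
  assumes "s \<in> carrier S" "s' \<in> carrier S"
    and "\<And>m. m \<in> carrier M \<Longrightarrow> m \<star>\<^bsub>M\<^esub> s = m \<star>\<^bsub>M\<^esub> s'"
  shows "s = s'"
proof -
  have "m \<star>\<^bsub>M\<^esub> (s \<ominus>\<^bsub>S\<^esub> s') = \<zero>\<^bsub>M\<^esub>" if "m \<in> carrier M" for m
    using assms that by (simp add: S.minus_eq smult_simps M.r_neg)
  then have "s \<ominus>\<^bsub>S\<^esub> s' = \<zero>\<^bsub>S\<^esub>"
    using right_faithful assms by (simp add: right_faithful_def)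
  then show ?thesis using assms(1,2) by (rule S.eq_if_diff_zero)
qed

lemma Tri_center_if_commutes_idempotents:
  assumes z: "z \<in> carrier T"
    and comm: "\<And>p. \<lbrakk>p \<in> carrier T; p \<otimes>\<^bsub>T\<^esub> p = p\<rbrakk> \<Longrightarrow> z \<otimes>\<^bsub>T\<^esub> p = p \<otimes>\<^bsub>T\<^esub> z"
  shows "z \<in> ring_center T"
proof -
  obtain c k c' where zc: "z = (c, k, c')"
    and c: "c \<in> carrier R" "k \<in> carrier M" "c' \<in> carrier S"
    using z by (rule Tri_carrierE)
  \<comment> \<open>The corner entries of \<open>zp\<close> and \<open>pz\<close> for the idempotent
    \<open>p\<close> with rows \<open>(1, m)\<close> and \<open>(0, 0)\<close>.\<close>
  have e: "c \<odot>\<^bsub>M\<^esub> m = k \<oplus>\<^bsub>M\<^esub> m \<star>\<^bsub>M\<^esub> c'" if "m \<in> carrier M" for m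
    using comm[of "(\<one>\<^bsub>R\<^esub>, m, \<zero>\<^bsub>S\<^esub>)"] that c by (simp add: zc Tri_simps smult_simps)
  have k: "k = \<zero>\<^bsub>M\<^esub>" using e[of "\<zero>\<^bsub>M\<^esub>"] c by (simp add: smult_simps)
  with e c have cm: "c \<odot>\<^bsub>M\<^esub> m = m \<star>\<^bsub>M\<^esub> c'" if "m \<in> carrier M" for m
    using that by (simp add: smult_simps)
  \<comment> \<open>Both sides act alike on every \<open>m\<close>:
    \<open>c(rm) = (rm)c' = r(mc') = r(cm)\<close>. The next fact is its mirror image.\<close>
  have cr: "c \<otimes>\<^bsub>R\<^esub> r = r \<otimes>\<^bsub>R\<^esub> c" if r: "r \<in> carrier R" for r
    using r c by (intro left_faithful_eq) (simp_all add: smult_simps cm)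
  have cs: "c' \<otimes>\<^bsub>S\<^esub> s = s \<otimes>\<^bsub>S\<^esub> c'" if s: "s \<in> carrier S" for s
    using s c by (intro right_faithful_eq) (simp_all add: smult_simps flip: cm)
  have "z \<otimes>\<^bsub>T\<^esub> x = x \<otimes>\<^bsub>T\<^esub> z" if "x \<in> carrier T" for x
    using that
  proof (rule Tri_carrierE)
    fix r m s assume "x = (r, m, s)" "r \<in> carrier R" "m \<in> carrier M" "s \<in> carrier S"
    then show ?thesis using c by (simp add: zc Tri_simps k smult_simps cr cs cm)
  qed
  then show ?thesis using z by (simp add: ring_center_def)
qed

text \<open>An element of the corner is a difference of two idempotents, so \<open>d\<close>
  vanishes on the corner. The corner is an ideal on which the diagonal entries act faithfully, which
  forces the diagonal of \<open>d x\<close> to be zero; the diagonal parts of \<open>x\<close> are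
  then reached by multiplying with the idempotents \<open>?e\<close> and \<open>?f\<close>.\<close>

lemma derivation_eq_zero_if_idempotent:
  assumes d: "derivation T d"
    and p: "\<And>p. \<lbrakk>p \<in> carrier T; p \<otimes>\<^bsub>T\<^esub> p = p\<rbrakk> \<Longrightarrow> d p = \<zero>\<^bsub>T\<^esub>"
    and x: "x \<in> carrier T"
  shows "d x = \<zero>\<^bsub>T\<^esub>"
proof -
  have a: "additive_map T d" using d by (simp add: derivation_def)
  have dm: "d (y \<otimes>\<^bsub>T\<^esub> z) = d y \<otimes>\<^bsub>T\<^esub> z \<oplus>\<^bsub>T\<^esub> y \<otimes>\<^bsub>T\<^esub> d z" if "y \<in> carrier T" "z \<in> carrier T" for y z
    using d that by (simp add: derivation_def)
  obtain r m s where xc: "x = (r, m, s)" "r \<in> carrier R" "m \<in> carrier M" "s \<in> carrier S"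
    using x by (rule Tri_carrierE)
  obtain u v w where dx: "d x = (u, v, w)" and uvw: "u \<in> carrier R" "v \<in> carrier M" "w \<in> carrier S"
    using T.additive_map_closed[OF a x] by (rule Tri_carrierE)
  let ?e = "(\<one>\<^bsub>R\<^esub>, \<zero>\<^bsub>M\<^esub>, \<zero>\<^bsub>S\<^esub>)" and ?f = "(\<zero>\<^bsub>R\<^esub>, \<zero>\<^bsub>M\<^esub>, \<one>\<^bsub>S\<^esub>)"
  have de: "d ?e = (\<zero>\<^bsub>R\<^esub>, \<zero>\<^bsub>M\<^esub>, \<zero>\<^bsub>S\<^esub>)" "d ?f = (\<zero>\<^bsub>R\<^esub>, \<zero>\<^bsub>M\<^esub>, \<zero>\<^bsub>S\<^esub>)"
    using p[of ?e] p[of ?f] by (simp_all add: Tri_simps smult_simps)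
  have dM: "d (\<zero>\<^bsub>R\<^esub>, n, \<zero>\<^bsub>S\<^esub>) = (\<zero>\<^bsub>R\<^esub>, \<zero>\<^bsub>M\<^esub>, \<zero>\<^bsub>S\<^esub>)" if "n \<in> carrier M" for n
  proof -
    have "d ((\<zero>\<^bsub>R\<^esub>, n, \<zero>\<^bsub>S\<^esub>) \<oplus>\<^bsub>T\<^esub> ?e) = \<zero>\<^bsub>T\<^esub>"
      using that by (intro p) (simp_all add: Tri_simps smult_simps)
    then show ?thesis
      using that T.additive_map_closed[OF a, of "(\<zero>\<^bsub>R\<^esub>, n, \<zero>\<^bsub>S\<^esub>)"] p[of ?e]
      by (simp add: T.additive_map_add[OF a] Tri_carrier_iff) (simp add: Tri_simps smult_simps)
  qed
  \<comment> \<open>The product of \<open>x\<close> with a corner element lies in the corner, where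
    \<open>d\<close> vanishes, so \<open>d(x)\<close> times that element is zero; its corner entry
    is \<open>u\<close> acting on \<open>n\<close>.\<close>
  have "u \<odot>\<^bsub>M\<^esub> n = \<zero>\<^bsub>M\<^esub>" if "n \<in> carrier M" for n
    using dm[OF x, of "(\<zero>\<^bsub>R\<^esub>, n, \<zero>\<^bsub>S\<^esub>)"] that xc dx uvw by (simp add: Tri_simps smult_simps dM)
  then have u: "u = \<zero>\<^bsub>R\<^esub>" using left_faithful uvw by (simp add: left_faithful_def)
  have "n \<star>\<^bsub>M\<^esub> w = \<zero>\<^bsub>M\<^esub>" if "n \<in> carrier M" for n
    using dm[OF _ x, of "(\<zero>\<^bsub>R\<^esub>, n, \<zero>\<^bsub>S\<^esub>)"] that xc dx uvw by (simp add: Tri_simps smult_simps dM)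
  then have w: "w = \<zero>\<^bsub>S\<^esub>" using right_faithful uvw by (simp add: right_faithful_def)
  have "d (r, \<zero>\<^bsub>M\<^esub>, \<zero>\<^bsub>S\<^esub>) = (\<zero>\<^bsub>R\<^esub>, \<zero>\<^bsub>M\<^esub>, \<zero>\<^bsub>S\<^esub>)"
    using dm[OF x, of ?e] xc dx uvw u by (simp add: Tri_simps smult_simps de)
  moreover have "d (\<zero>\<^bsub>R\<^esub>, \<zero>\<^bsub>M\<^esub>, s) = (\<zero>\<^bsub>R\<^esub>, \<zero>\<^bsub>M\<^esub>, \<zero>\<^bsub>S\<^esub>)"
    using dm[OF _ x, of ?f] xc dx uvw w by (simp add: Tri_simps smult_simps de)
  moreover have "x = (r, \<zero>\<^bsub>M\<^esub>, \<zero>\<^bsub>S\<^esub>) \<oplus>\<^bsub>T\<^esub> ((\<zero>\<^bsub>R\<^esub>, m, \<zero>\<^bsub>S\<^esub>) \<oplus>\<^bsub>T\<^esub> (\<zero>\<^bsub>R\<^esub>, \<zero>\<^bsub>M\<^esub>, s))"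
    using xc by (simp add: Tri_simps)
  ultimately show ?thesis
    using xc dM[of m] by (simp add: T.additive_map_add[OF a] Tri_carrier_iff) (simp add: Tri_simps)
qed

section \<open>Entries of a zero product map that kills the identity\<close>

text \<open>Each Peirce component of \<open>d\<close> is determined by pairing it with an idempotent
  that annihilates it. The outcome \<open>d_eq\<close> is the map with entries \<alpha>, \<beta>,
  \<gamma> plus the inner derivation sending \<open>X\<close> to \<open>XN - NX\<close>, where
  \<open>N\<close> has the single nonzero entry \<open>n\<close>; the product rules for \<alpha>,
  \<beta>, \<gamma> then finish the proof.\<close>

lemma zero_product_jordan_derivation:
  assumes tor: "two_torsion_free R" "two_torsion_free S"
    and a: "additive_map T d" and z: "zero_product_jordan T d d" and d1: "d \<one>\<^bsub>T\<^esub> = \<zero>\<^bsub>T\<^esub>"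
  shows "derivation T d"
proof -
  have tor_R: "u = \<zero>\<^bsub>R\<^esub>" if "u \<oplus>\<^bsub>R\<^esub> u = \<zero>\<^bsub>R\<^esub>" "u \<in> carrier R" for u
    using tor(1) that unfolding two_torsion_free_def by blast
  have tor_S: "w = \<zero>\<^bsub>S\<^esub>" if "w \<oplus>\<^bsub>S\<^esub> w = \<zero>\<^bsub>S\<^esub>" "w \<in> carrier S" for w
    using tor(2) that unfolding two_torsion_free_def by blast
  note d_add = T.additive_map_add[OF a]
  have peirce: "d (r, m, s) =
      d (r, \<zero>\<^bsub>M\<^esub>, \<zero>\<^bsub>S\<^esub>) \<oplus>\<^bsub>T\<^esub> (d (\<zero>\<^bsub>R\<^esub>, m, \<zero>\<^bsub>S\<^esub>) \<oplus>\<^bsub>T\<^esub> d (\<zero>\<^bsub>R\<^esub>, \<zero>\<^bsub>M\<^esub>, s))"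
    if "r \<in> carrier R" "m \<in> carrier M" "s \<in> carrier S" for r m s
    using that by (simp flip: d_add add: Tri_simps)

  have idem: "\<exists>v\<in>carrier M. d (\<one>\<^bsub>R\<^esub>, m, \<zero>\<^bsub>S\<^esub>) = (\<zero>\<^bsub>R\<^esub>, v, \<zero>\<^bsub>S\<^esub>)" if m: "m \<in> carrier M" for m
  proof -
    \<comment> \<open>Here \<open>?p + ?q\<close> is the identity, so \<open>d ?q = - d ?p\<close>.
      The diagonal entries of the zero product relation are then \<open>-2u\<close> and
      \<open>2w\<close>, which is where torsion-freeness enters.\<close>
    let ?p = "(\<one>\<^bsub>R\<^esub>, m, \<zero>\<^bsub>S\<^esub>)" and ?q = "(\<zero>\<^bsub>R\<^esub>, \<ominus>\<^bsub>M\<^esub> m, \<one>\<^bsub>S\<^esub>)"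
    have c: "?p \<in> carrier T" "?q \<in> carrier T" using m by (auto simp: Tri_simps)
    obtain u v w where dp: "d ?p = (u, v, w)"
      and uvw: "u \<in> carrier R" "v \<in> carrier M" "w \<in> carrier S"
      using T.additive_map_closed[OF a c(1)] by (rule Tri_carrierE)
    have "d ?q \<oplus>\<^bsub>T\<^esub> d ?p = \<zero>\<^bsub>T\<^esub>"
      using d1 m by (simp add: Tri_simps M.l_neg flip: d_add)
    then have "d ?q = \<ominus>\<^bsub>T\<^esub> d ?p"
      using T.minus_equality T.additive_map_closed[OF a] c by metis
    then have dq: "d ?q = (\<ominus>\<^bsub>R\<^esub> u, \<ominus>\<^bsub>M\<^esub> v, \<ominus>\<^bsub>S\<^esub> w)"
      using uvw by (simp add: dp Tri_minus)
    have "\<ominus>\<^bsub>R\<^esub> u \<oplus>\<^bsub>R\<^esub> \<ominus>\<^bsub>R\<^esub> u = \<zero>\<^bsub>R\<^esub>" "w \<oplus>\<^bsub>S\<^esub> w = \<zero>\<^bsub>S\<^esub>"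
      using zero_product_jordanD[OF z c] m uvw by (auto simp: dp dq Tri_simps smult_simps M.l_neg M.r_neg)
    then have "u = \<zero>\<^bsub>R\<^esub>" "w = \<zero>\<^bsub>S\<^esub>"
      using tor_R[of "\<ominus>\<^bsub>R\<^esub> u"] tor_S[of w] uvw by auto
    then show ?thesis using dp uvw by auto
  qed
  obtain n where n: "n \<in> carrier M" and de: "d (\<one>\<^bsub>R\<^esub>, \<zero>\<^bsub>M\<^esub>, \<zero>\<^bsub>S\<^esub>) = (\<zero>\<^bsub>R\<^esub>, n, \<zero>\<^bsub>S\<^esub>)"
    using idem[of "\<zero>\<^bsub>M\<^esub>"] by auto
  have df: "d (\<zero>\<^bsub>R\<^esub>, \<zero>\<^bsub>M\<^esub>, \<one>\<^bsub>S\<^esub>) = (\<zero>\<^bsub>R\<^esub>, \<ominus>\<^bsub>M\<^esub> n, \<zero>\<^bsub>S\<^esub>)"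
  proof -
    have "d (\<zero>\<^bsub>R\<^esub>, \<zero>\<^bsub>M\<^esub>, \<one>\<^bsub>S\<^esub>) \<oplus>\<^bsub>T\<^esub> d (\<one>\<^bsub>R\<^esub>, \<zero>\<^bsub>M\<^esub>, \<zero>\<^bsub>S\<^esub>) = \<zero>\<^bsub>T\<^esub>"
      using d1 by (simp add: Tri_simps flip: d_add)
    then have "d (\<zero>\<^bsub>R\<^esub>, \<zero>\<^bsub>M\<^esub>, \<one>\<^bsub>S\<^esub>) = \<ominus>\<^bsub>T\<^esub> d (\<one>\<^bsub>R\<^esub>, \<zero>\<^bsub>M\<^esub>, \<zero>\<^bsub>S\<^esub>)"
      by (intro T.minus_equality[symmetric] T.additive_map_closed[OF a]) (simp_all add: Tri_carrier_iff)
    then show ?thesis using n by (simp add: de Tri_minus)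
  qed

  \<comment> \<open>A corner element is the difference of the idempotents with corner
    \<open>m\<close> and \<open>0\<close>, and \<open>d\<close> sends both into the corner.\<close>
  have "\<exists>v\<in>carrier M. d (\<zero>\<^bsub>R\<^esub>, m, \<zero>\<^bsub>S\<^esub>) = (\<zero>\<^bsub>R\<^esub>, v, \<zero>\<^bsub>S\<^esub>)" if m: "m \<in> carrier M" for m
  proof -
    have c: "(\<zero>\<^bsub>R\<^esub>, m, \<zero>\<^bsub>S\<^esub>) \<in> carrier T" using m by (simp add: Tri_carrier_iff)
    obtain u v w where dm: "d (\<zero>\<^bsub>R\<^esub>, m, \<zero>\<^bsub>S\<^esub>) = (u, v, w)"
      and uvw: "u \<in> carrier R" "v \<in> carrier M" "w \<in> carrier S"
      using T.additive_map_closed[OF a c] by (rule Tri_carrierE)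
    have "d (\<zero>\<^bsub>R\<^esub>, m, \<zero>\<^bsub>S\<^esub>) \<oplus>\<^bsub>T\<^esub> d (\<one>\<^bsub>R\<^esub>, \<zero>\<^bsub>M\<^esub>, \<zero>\<^bsub>S\<^esub>) = d (\<one>\<^bsub>R\<^esub>, m, \<zero>\<^bsub>S\<^esub>)"
      using m by (simp add: Tri_simps flip: d_add)
    then show ?thesis
      using idem[OF m] uvw n by (auto simp: dm de Tri_simps)
  qed
  then obtain \<beta> where \<beta>: "\<And>m. m \<in> carrier M \<Longrightarrow> \<beta> m \<in> carrier M"
    and dM: "\<And>m. m \<in> carrier M \<Longrightarrow> d (\<zero>\<^bsub>R\<^esub>, m, \<zero>\<^bsub>S\<^esub>) = (\<zero>\<^bsub>R\<^esub>, \<beta> m, \<zero>\<^bsub>S\<^esub>)"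
    by metis
  have \<beta>_add: "\<beta> (m \<oplus>\<^bsub>M\<^esub> m') = \<beta> m \<oplus>\<^bsub>M\<^esub> \<beta> m'" if "m \<in> carrier M" "m' \<in> carrier M" for m m'
    using d_add[of "(\<zero>\<^bsub>R\<^esub>, m, \<zero>\<^bsub>S\<^esub>)" "(\<zero>\<^bsub>R\<^esub>, m', \<zero>\<^bsub>S\<^esub>)"] that by (simp add: Tri_simps dM)
  have \<beta>_minus: "\<beta> (\<ominus>\<^bsub>M\<^esub> m) = \<ominus>\<^bsub>M\<^esub> \<beta> m" if "m \<in> carrier M" for m
    using T.additive_map_minus[OF a, of "(\<zero>\<^bsub>R\<^esub>, m, \<zero>\<^bsub>S\<^esub>)"] that \<beta>
    by (simp add: Tri_minus Tri_carrier_iff dM)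

  have "\<exists>u\<in>carrier R. d (r, \<zero>\<^bsub>M\<^esub>, \<zero>\<^bsub>S\<^esub>) = (u, r \<odot>\<^bsub>M\<^esub> n, \<zero>\<^bsub>S\<^esub>)" if r: "r \<in> carrier R" for r
  proof -
    let ?x = "(r, \<zero>\<^bsub>M\<^esub>, \<zero>\<^bsub>S\<^esub>)" and ?f = "(\<zero>\<^bsub>R\<^esub>, \<zero>\<^bsub>M\<^esub>, \<one>\<^bsub>S\<^esub>)"
    have c: "?x \<in> carrier T" "?f \<in> carrier T" using r by (simp_all add: Tri_carrier_iff)
    obtain u v w where dx: "d ?x = (u, v, w)"
      and uvw: "u \<in> carrier R" "v \<in> carrier M" "w \<in> carrier S"
      using T.additive_map_closed[OF a c(1)] by (rule Tri_carrierE)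
    \<comment> \<open>Because \<open>d ?f\<close> has corner \<open>-n\<close>, the corner entry of
      the relation ties \<open>v\<close> to \<open>n\<close>, while the other diagonal entry is
      counted twice.\<close>
    have e: "\<ominus>\<^bsub>M\<^esub> (r \<odot>\<^bsub>M\<^esub> n) \<oplus>\<^bsub>M\<^esub> v = \<zero>\<^bsub>M\<^esub>" "w \<oplus>\<^bsub>S\<^esub> w = \<zero>\<^bsub>S\<^esub>"
      using zero_product_jordanD[OF z c] r n uvw by (auto simp: dx df Tri_simps smult_simps)
    have "v = r \<odot>\<^bsub>M\<^esub> n"
      using M.eq_if_diff_zero[of v "r \<odot>\<^bsub>M\<^esub> n"] e(1) r n uvw by (simp add: M.minus_eq M.a_comm lsmult_closed)
    moreover have "w = \<zero>\<^bsub>S\<^esub>" using tor_S[OF e(2)] uvw by simp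
    ultimately show ?thesis using dx uvw by auto
  qed
  then obtain \<alpha> where \<alpha>: "\<And>r. r \<in> carrier R \<Longrightarrow> \<alpha> r \<in> carrier R"
    and dR: "\<And>r. r \<in> carrier R \<Longrightarrow> d (r, \<zero>\<^bsub>M\<^esub>, \<zero>\<^bsub>S\<^esub>) = (\<alpha> r, r \<odot>\<^bsub>M\<^esub> n, \<zero>\<^bsub>S\<^esub>)"
    by metis

  have "\<exists>w\<in>carrier S. d (\<zero>\<^bsub>R\<^esub>, \<zero>\<^bsub>M\<^esub>, s) = (\<zero>\<^bsub>R\<^esub>, \<ominus>\<^bsub>M\<^esub> (n \<star>\<^bsub>M\<^esub> s), w)" if s: "s \<in> carrier S" for s
  proof -
    let ?e = "(\<one>\<^bsub>R\<^esub>, \<zero>\<^bsub>M\<^esub>, \<zero>\<^bsub>S\<^esub>)" and ?y = "(\<zero>\<^bsub>R\<^esub>, \<zero>\<^bsub>M\<^esub>, s)"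
    have c: "?e \<in> carrier T" "?y \<in> carrier T" using s by (simp_all add: Tri_carrier_iff)
    obtain u v w where dy: "d ?y = (u, v, w)"
      and uvw: "u \<in> carrier R" "v \<in> carrier M" "w \<in> carrier S"
      using T.additive_map_closed[OF a c(2)] by (rule Tri_carrierE)
    have e: "v \<oplus>\<^bsub>M\<^esub> n \<star>\<^bsub>M\<^esub> s = \<zero>\<^bsub>M\<^esub>" "u \<oplus>\<^bsub>R\<^esub> u = \<zero>\<^bsub>R\<^esub>"
      using zero_product_jordanD[OF z c] s n uvw by (auto simp: dy de Tri_simps smult_simps)
    have "v = \<ominus>\<^bsub>M\<^esub> (n \<star>\<^bsub>M\<^esub> s)"
      using M.minus_equality[OF e(1)] s n uvw by (simp add: smult_simps)
    moreover have "u = \<zero>\<^bsub>R\<^esub>" using tor_R[OF e(2)] uvw by simp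
    ultimately show ?thesis using dy uvw by auto
  qed
  then obtain \<gamma> where \<gamma>: "\<And>s. s \<in> carrier S \<Longrightarrow> \<gamma> s \<in> carrier S"
    and dS: "\<And>s. s \<in> carrier S \<Longrightarrow> d (\<zero>\<^bsub>R\<^esub>, \<zero>\<^bsub>M\<^esub>, s) = (\<zero>\<^bsub>R\<^esub>, \<ominus>\<^bsub>M\<^esub> (n \<star>\<^bsub>M\<^esub> s), \<gamma> s)"
    by metis
  have \<alpha>1: "\<alpha> \<one>\<^bsub>R\<^esub> = \<zero>\<^bsub>R\<^esub>" and \<gamma>1: "\<gamma> \<one>\<^bsub>S\<^esub> = \<zero>\<^bsub>S\<^esub>"
    using de dR[of "\<one>\<^bsub>R\<^esub>"] df dS[of "\<one>\<^bsub>S\<^esub>"] by auto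

  have d_eq: "d (r, m, s) = (\<alpha> r, (r \<odot>\<^bsub>M\<^esub> n \<oplus>\<^bsub>M\<^esub> \<beta> m) \<ominus>\<^bsub>M\<^esub> n \<star>\<^bsub>M\<^esub> s, \<gamma> s)"
    if "r \<in> carrier R" "m \<in> carrier M" "s \<in> carrier S" for r m s
    unfolding peirce[OF that] using that \<alpha> \<beta> \<gamma> n
    by (simp add: dR dM dS Tri_simps M.minus_eq M.a_assoc smult_simps)

  have \<beta>_left: "\<beta> (r \<odot>\<^bsub>M\<^esub> m) = \<alpha> r \<odot>\<^bsub>M\<^esub> m \<oplus>\<^bsub>M\<^esub> r \<odot>\<^bsub>M\<^esub> \<beta> m"
    if c: "r \<in> carrier R" "m \<in> carrier M" for r m
  proof -
    \<comment> \<open>The matrices \<open>?x\<close> and \<open>?y\<close> annihilate each other because \<open>r m\<close> cancels in the corner.\<close>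
    let ?x = "(r, \<ominus>\<^bsub>M\<^esub> (r \<odot>\<^bsub>M\<^esub> m), \<zero>\<^bsub>S\<^esub>)" and ?y = "(\<zero>\<^bsub>R\<^esub>, m, \<one>\<^bsub>S\<^esub>)"
    have xy: "?x \<in> carrier T" "?y \<in> carrier T" "?x \<otimes>\<^bsub>T\<^esub> ?y = \<zero>\<^bsub>T\<^esub>" "?y \<otimes>\<^bsub>T\<^esub> ?x = \<zero>\<^bsub>T\<^esub>"
      using c by (simp_all add: Tri_simps smult_simps M.r_neg)
    have dx: "d ?x = (\<alpha> r, r \<odot>\<^bsub>M\<^esub> n \<ominus>\<^bsub>M\<^esub> \<beta> (r \<odot>\<^bsub>M\<^esub> m), \<zero>\<^bsub>S\<^esub>)"
      unfolding peirce[OF c(1) M.a_inv_closed[OF lsmult_closed[OF c]] S.zero_closed]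
      using c n \<alpha> \<beta> T.additive_map_zero[OF a]
      by (simp add: dR dM Tri_simps smult_simps \<beta>_minus M.minus_eq)
    have dy: "d ?y = (\<zero>\<^bsub>R\<^esub>, \<beta> m \<ominus>\<^bsub>M\<^esub> n, \<zero>\<^bsub>S\<^esub>)"
      unfolding peirce[OF R.zero_closed c(2) S.one_closed]
      using c n \<beta> T.additive_map_zero[OF a] by (simp add: df dM Tri_simps M.minus_eq)
    have "r \<odot>\<^bsub>M\<^esub> (\<beta> m \<ominus>\<^bsub>M\<^esub> n) \<oplus>\<^bsub>M\<^esub>
        (\<alpha> r \<odot>\<^bsub>M\<^esub> m \<oplus>\<^bsub>M\<^esub> (r \<odot>\<^bsub>M\<^esub> n \<ominus>\<^bsub>M\<^esub> \<beta> (r \<odot>\<^bsub>M\<^esub> m))) = \<zero>\<^bsub>M\<^esub>"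
      using zero_product_jordanD[OF z xy] c n \<alpha> \<beta> by (simp add: dx dy Tri_simps smult_simps M.a_inv_zero)
    \<comment> \<open>The two terms with \<open>n\<close> cancel, and the rest of the corner entry
      is the product rule for \<beta>.\<close>
    moreover have "r \<odot>\<^bsub>M\<^esub> (\<beta> m \<ominus>\<^bsub>M\<^esub> n) \<oplus>\<^bsub>M\<^esub>
        (\<alpha> r \<odot>\<^bsub>M\<^esub> m \<oplus>\<^bsub>M\<^esub> (r \<odot>\<^bsub>M\<^esub> n \<ominus>\<^bsub>M\<^esub> \<beta> (r \<odot>\<^bsub>M\<^esub> m)))
      = (\<alpha> r \<odot>\<^bsub>M\<^esub> m \<oplus>\<^bsub>M\<^esub> r \<odot>\<^bsub>M\<^esub> \<beta> m) \<ominus>\<^bsub>M\<^esub> \<beta> (r \<odot>\<^bsub>M\<^esub> m)"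
      using c n \<alpha> \<beta> by (simp add: lsmult_diff smult_simps M.add_diff_cancel_left)
    ultimately show ?thesis
      using M.eq_if_diff_zero c \<alpha> \<beta> by (metis M.a_closed lsmult_closed)
  qed

  have \<beta>_right: "\<beta> (m \<star>\<^bsub>M\<^esub> s) = \<beta> m \<star>\<^bsub>M\<^esub> s \<oplus>\<^bsub>M\<^esub> m \<star>\<^bsub>M\<^esub> \<gamma> s"
    if c: "m \<in> carrier M" "s \<in> carrier S" for m s
  proof -
    \<comment> \<open>Mirror image of the previous pair: the terms \<open>-ms\<close> and
      \<open>ms\<close> cancel in the corner of \<open>?x ?y\<close>, and \<open>?y ?x\<close> is
      zero entry by entry.\<close>
    let ?x = "(\<one>\<^bsub>R\<^esub>, m, \<zero>\<^bsub>S\<^esub>)" and ?y = "(\<zero>\<^bsub>R\<^esub>, \<ominus>\<^bsub>M\<^esub> (m \<star>\<^bsub>M\<^esub> s), s)"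
    have xy: "?x \<in> carrier T" "?y \<in> carrier T" "?x \<otimes>\<^bsub>T\<^esub> ?y = \<zero>\<^bsub>T\<^esub>" "?y \<otimes>\<^bsub>T\<^esub> ?x = \<zero>\<^bsub>T\<^esub>"
      using c by (simp_all add: Tri_simps smult_simps M.l_neg)
    have dx: "d ?x = (\<zero>\<^bsub>R\<^esub>, n \<oplus>\<^bsub>M\<^esub> \<beta> m, \<zero>\<^bsub>S\<^esub>)"
      unfolding peirce[OF R.one_closed c(1) S.zero_closed]
      using c n \<beta> T.additive_map_zero[OF a] by (simp add: de dM Tri_simps)
    have dy: "d ?y = (\<zero>\<^bsub>R\<^esub>, \<ominus>\<^bsub>M\<^esub> \<beta> (m \<star>\<^bsub>M\<^esub> s) \<ominus>\<^bsub>M\<^esub> n \<star>\<^bsub>M\<^esub> s, \<gamma> s)"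
      unfolding peirce[OF R.zero_closed M.a_inv_closed[OF rsmult_closed[OF c]] c(2)]
      using c n \<beta> \<gamma> T.additive_map_zero[OF a]
      by (simp add: dS dM Tri_simps smult_simps \<beta>_minus M.minus_eq)
    have "(\<ominus>\<^bsub>M\<^esub> \<beta> (m \<star>\<^bsub>M\<^esub> s) \<ominus>\<^bsub>M\<^esub> n \<star>\<^bsub>M\<^esub> s \<oplus>\<^bsub>M\<^esub> m \<star>\<^bsub>M\<^esub> \<gamma> s) \<oplus>\<^bsub>M\<^esub>
        (n \<oplus>\<^bsub>M\<^esub> \<beta> m) \<star>\<^bsub>M\<^esub> s = \<zero>\<^bsub>M\<^esub>"
      using zero_product_jordanD[OF z xy] c n \<beta> \<gamma> by (simp add: dx dy Tri_simps smult_simps M.a_inv_zero)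
    moreover have "(\<ominus>\<^bsub>M\<^esub> \<beta> (m \<star>\<^bsub>M\<^esub> s) \<ominus>\<^bsub>M\<^esub> n \<star>\<^bsub>M\<^esub> s \<oplus>\<^bsub>M\<^esub> m \<star>\<^bsub>M\<^esub> \<gamma> s) \<oplus>\<^bsub>M\<^esub>
        (n \<oplus>\<^bsub>M\<^esub> \<beta> m) \<star>\<^bsub>M\<^esub> s
      = (\<beta> m \<star>\<^bsub>M\<^esub> s \<oplus>\<^bsub>M\<^esub> m \<star>\<^bsub>M\<^esub> \<gamma> s) \<ominus>\<^bsub>M\<^esub> \<beta> (m \<star>\<^bsub>M\<^esub> s)"
      using c n \<gamma> \<beta> by (simp only: smult_simps M.add_diff_cancel_right)
    ultimately show ?thesis
      using M.eq_if_diff_zero c \<gamma> \<beta> by (metis M.a_closed rsmult_closed)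
  qed

  have \<alpha>_mult: "\<alpha> (r \<otimes>\<^bsub>R\<^esub> r') = \<alpha> r \<otimes>\<^bsub>R\<^esub> r' \<oplus>\<^bsub>R\<^esub> r \<otimes>\<^bsub>R\<^esub> \<alpha> r'"
    if c: "r \<in> carrier R" "r' \<in> carrier R" for r r'
  proof (rule left_faithful_eq)
    fix m assume m: "m \<in> carrier M"
    \<comment> \<open>Computing \<beta> of \<open>(rr')m\<close> in one step and in two steps gives
      two expressions with the common summand \<open>r(r' \<beta>(m))\<close>. Cancelling it leaves
      an equality of left actions on \<open>m\<close>, and faithfulness does the rest.\<close>
    have "\<alpha> (r \<otimes>\<^bsub>R\<^esub> r') \<odot>\<^bsub>M\<^esub> m \<oplus>\<^bsub>M\<^esub> r \<odot>\<^bsub>M\<^esub> (r' \<odot>\<^bsub>M\<^esub> \<beta> m) = \<beta> (r \<odot>\<^bsub>M\<^esub> (r' \<odot>\<^bsub>M\<^esub> m))"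
      using \<beta>_left[of "r \<otimes>\<^bsub>R\<^esub> r'" m] c m \<beta> by (simp add: smult_simps)
    also have "\<dots> = (\<alpha> r \<otimes>\<^bsub>R\<^esub> r' \<oplus>\<^bsub>R\<^esub> r \<otimes>\<^bsub>R\<^esub> \<alpha> r') \<odot>\<^bsub>M\<^esub> m \<oplus>\<^bsub>M\<^esub> r \<odot>\<^bsub>M\<^esub> (r' \<odot>\<^bsub>M\<^esub> \<beta> m)"
      using c m \<alpha> \<beta> by (simp add: smult_simps \<beta>_left M.a_assoc)
    finally show "\<alpha> (r \<otimes>\<^bsub>R\<^esub> r') \<odot>\<^bsub>M\<^esub> m = (\<alpha> r \<otimes>\<^bsub>R\<^esub> r' \<oplus>\<^bsub>R\<^esub> r \<otimes>\<^bsub>R\<^esub> \<alpha> r') \<odot>\<^bsub>M\<^esub> m"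
      using M.add.right_cancel c m \<alpha> \<beta> by (metis R.m_closed R.a_closed lsmult_closed)
  qed (use c \<alpha> in auto)

  have \<gamma>_mult: "\<gamma> (s \<otimes>\<^bsub>S\<^esub> s') = \<gamma> s \<otimes>\<^bsub>S\<^esub> s' \<oplus>\<^bsub>S\<^esub> s \<otimes>\<^bsub>S\<^esub> \<gamma> s'"
    if c: "s \<in> carrier S" "s' \<in> carrier S" for s s'
  proof (rule right_faithful_eq)
    fix m assume m: "m \<in> carrier M"
    have "m \<star>\<^bsub>M\<^esub> \<gamma> (s \<otimes>\<^bsub>S\<^esub> s') \<oplus>\<^bsub>M\<^esub> \<beta> m \<star>\<^bsub>M\<^esub> s \<star>\<^bsub>M\<^esub> s' = \<beta> (m \<star>\<^bsub>M\<^esub> s \<star>\<^bsub>M\<^esub> s')"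
      using \<beta>_right[of m "s \<otimes>\<^bsub>S\<^esub> s'"] c m \<beta> \<gamma> by (simp add: smult_simps M.a_comm)
    also have "\<dots> = m \<star>\<^bsub>M\<^esub> (\<gamma> s \<otimes>\<^bsub>S\<^esub> s' \<oplus>\<^bsub>S\<^esub> s \<otimes>\<^bsub>S\<^esub> \<gamma> s') \<oplus>\<^bsub>M\<^esub> \<beta> m \<star>\<^bsub>M\<^esub> s \<star>\<^bsub>M\<^esub> s'"
      using c m \<gamma> \<beta> by (simp add: smult_simps \<beta>_right M.a_ac)
    finally show "m \<star>\<^bsub>M\<^esub> \<gamma> (s \<otimes>\<^bsub>S\<^esub> s') = m \<star>\<^bsub>M\<^esub> (\<gamma> s \<otimes>\<^bsub>S\<^esub> s' \<oplus>\<^bsub>S\<^esub> s \<otimes>\<^bsub>S\<^esub> \<gamma> s')"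
      using M.add.right_cancel c m \<gamma> \<beta> by (metis S.m_closed S.a_closed rsmult_closed)
  qed (use c \<gamma> in auto)

  have "d (x \<otimes>\<^bsub>T\<^esub> y) = d x \<otimes>\<^bsub>T\<^esub> y \<oplus>\<^bsub>T\<^esub> x \<otimes>\<^bsub>T\<^esub> d y" if x: "x \<in> carrier T" and y: "y \<in> carrier T" for x y
  proof -
    obtain r m s where xc: "x = (r, m, s)" "r \<in> carrier R" "m \<in> carrier M" "s \<in> carrier S"
      using x by (rule Tri_carrierE)
    obtain r' m' s' where yc: "y = (r', m', s')" "r' \<in> carrier R" "m' \<in> carrier M" "s' \<in> carrier S"
      using y by (rule Tri_carrierE)
    show ?thesis
      \<comment> \<open>The diagonal entries are the product rules for \<alpha> and \<gamma>. In the
        corner, the mixed term \<open>r n s'\<close> comes once from \<open>d(x) y\<close> and once,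
        with opposite sign, from \<open>x d(y)\<close>.\<close>
      using xc(2-) yc(2-) \<alpha> \<beta> \<gamma> n
      by (simp add: xc(1) yc(1) Tri_simps d_eq lsmult_diff rsmult_diff smult_simps \<alpha>_mult \<gamma>_mult
          \<beta>_add \<beta>_left \<beta>_right M.add_diff_cancel_middle)
  qed
  then show ?thesis using a by (simp add: derivation_def)
qed

section \<open>Zero product maps as derivations plus central multiplications\<close>

text \<open>Centrality of \<open>f 1\<close> has to come first: it makes multiplication by
  \<open>f 1\<close> satisfy the zero product condition, so the difference satisfies it too and
  kills the identity.\<close>

lemma zero_product_jordan_eq_derivation_plus_central:
  assumes tor: "two_torsion_free R" "two_torsion_free S"
    and a: "additive_map T f" and z: "zero_product_jordan T f f"
  shows "f \<one>\<^bsub>T\<^esub> \<in> ring_center T"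
    and "derivation T (\<lambda>x. f x \<ominus>\<^bsub>T\<^esub> x \<otimes>\<^bsub>T\<^esub> f \<one>\<^bsub>T\<^esub>)"
proof -
  have c: "f \<one>\<^bsub>T\<^esub> \<in> carrier T" using T.additive_map_closed[OF a] by simp
  show center: "f \<one>\<^bsub>T\<^esub> \<in> ring_center T"
    using T.zero_product_jordan_one_commutes_idempotent[OF a z] c
    by (intro Tri_center_if_commutes_idempotents)
  have m: "additive_map T (\<lambda>x. x \<otimes>\<^bsub>T\<^esub> f \<one>\<^bsub>T\<^esub>)" by (rule T.additive_map_mult_right[OF c])
  show "derivation T (\<lambda>x. f x \<ominus>\<^bsub>T\<^esub> x \<otimes>\<^bsub>T\<^esub> f \<one>\<^bsub>T\<^esub>)"
  proof (rule zero_product_jordan_derivation[OF tor])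
    show "additive_map T (\<lambda>x. f x \<ominus>\<^bsub>T\<^esub> x \<otimes>\<^bsub>T\<^esub> f \<one>\<^bsub>T\<^esub>)"
      by (rule T.additive_map_diff[OF a m])
    show "zero_product_jordan T (\<lambda>x. f x \<ominus>\<^bsub>T\<^esub> x \<otimes>\<^bsub>T\<^esub> f \<one>\<^bsub>T\<^esub>) (\<lambda>x. f x \<ominus>\<^bsub>T\<^esub> x \<otimes>\<^bsub>T\<^esub> f \<one>\<^bsub>T\<^esub>)"
      by (rule T.zero_product_jordan_diff[OF a a m m z T.zero_product_jordan_mult_center(1)[OF center]])
    show "f \<one>\<^bsub>T\<^esub> \<ominus>\<^bsub>T\<^esub> \<one>\<^bsub>T\<^esub> \<otimes>\<^bsub>T\<^esub> f \<one>\<^bsub>T\<^esub> = \<zero>\<^bsub>T\<^esub>"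
      using c by (simp add: T.minus_eq T.r_neg)
  qed
qed

text \<open>The derivation part \<open>?d\<close> of \<open>g\<close> inherits the condition with
  first map zero, since multiplication by a central element satisfies it as well. Such a derivation
  kills every idempotent and hence is zero.\<close>

lemma zero_product_centralizer:
  assumes tor: "two_torsion_free R" "two_torsion_free S"
    and g: "additive_map T g" and z: "zero_product_jordan T (\<lambda>_. \<zero>\<^bsub>T\<^esub>) g"
  shows "g \<one>\<^bsub>T\<^esub> \<in> ring_center T"
    and "x \<in> carrier T \<Longrightarrow> g x = x \<otimes>\<^bsub>T\<^esub> g \<one>\<^bsub>T\<^esub>"
proof -
  let ?d = "\<lambda>x. g x \<ominus>\<^bsub>T\<^esub> x \<otimes>\<^bsub>T\<^esub> g \<one>\<^bsub>T\<^esub>"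
  have zz: "zero_product_jordan T g g" by (rule T.zero_product_jordan_zero_left[OF g z])
  note d = zero_product_jordan_eq_derivation_plus_central(2)[OF tor g zz]
  show center: "g \<one>\<^bsub>T\<^esub> \<in> ring_center T"
    by (rule zero_product_jordan_eq_derivation_plus_central(1)[OF tor g zz])
  have c: "g \<one>\<^bsub>T\<^esub> \<in> carrier T" using T.additive_map_closed[OF g] by simp
  have zero: "additive_map T (\<lambda>_. \<zero>\<^bsub>T\<^esub>)" by (simp add: additive_map_def hom_def)
  have "zero_product_jordan T (\<lambda>x. \<zero>\<^bsub>T\<^esub> \<ominus>\<^bsub>T\<^esub> \<zero>\<^bsub>T\<^esub>) ?d"
    by (rule T.zero_product_jordan_diff[OF zero g zero T.additive_map_mult_right[OF c] z
          T.zero_product_jordan_mult_center(2)[OF center]])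
  then have dz: "zero_product_jordan T (\<lambda>_. \<zero>\<^bsub>T\<^esub>) ?d" by (simp add: T.minus_eq)
  show "g x = x \<otimes>\<^bsub>T\<^esub> g \<one>\<^bsub>T\<^esub>" if x: "x \<in> carrier T"
  proof (rule T.eq_if_diff_zero)
    show "?d x = \<zero>\<^bsub>T\<^esub>"
      by (rule derivation_eq_zero_if_idempotent[OF d T.zero_product_jordan_derivation_idempotent[OF d dz] x])
  qed (use x c T.additive_map_closed[OF g x] in auto)
qed

text \<open>The passage from (iv) to (i), with \<open>f\<close> for \<delta> and \<open>g\<close>
  for \<tau>. Since \<open>g - f\<close> is multiplication by a central element, the derivation part
  of \<open>f\<close> serves for \<open>g\<close> too.\<close>

lemma zero_product_jordan_generalized_derivation:
  assumes tor: "two_torsion_free R" "two_torsion_free S"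
    and f: "additive_map T f" and g: "additive_map T g"
    and zf: "zero_product_jordan T f f" and zfg: "zero_product_jordan T f g"
  shows "g \<one>\<^bsub>T\<^esub> \<in> ring_center T"
    and "\<exists>d. derivation T d \<and> (\<forall>x\<in>carrier T. g x = d x \<oplus>\<^bsub>T\<^esub> x \<otimes>\<^bsub>T\<^esub> g \<one>\<^bsub>T\<^esub>)"
proof -
  let ?h = "\<lambda>x. g x \<ominus>\<^bsub>T\<^esub> f x"
  let ?d = "\<lambda>x. f x \<ominus>\<^bsub>T\<^esub> x \<otimes>\<^bsub>T\<^esub> f \<one>\<^bsub>T\<^esub>"
  note closed = T.additive_map_closed[OF f] T.additive_map_closed[OF g]
  have "zero_product_jordan T (\<lambda>x. f x \<ominus>\<^bsub>T\<^esub> f x) ?h"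
    by (rule T.zero_product_jordan_diff[OF f g f f zfg zf])
  then have "zero_product_jordan T (\<lambda>_. \<zero>\<^bsub>T\<^esub>) ?h"
    using closed by (simp add: zero_product_jordan_def T.minus_eq T.r_neg)
  note h = zero_product_centralizer[OF tor T.additive_map_diff[OF g f] this]
  note fd = zero_product_jordan_eq_derivation_plus_central[OF tor f zf]
  have g_eq: "g x = ?h x \<oplus>\<^bsub>T\<^esub> f x" if "x \<in> carrier T" for x
    using closed[OF that] by (simp add: T.minus_eq T.a_assoc T.l_neg)
  have "?h \<one>\<^bsub>T\<^esub> \<oplus>\<^bsub>T\<^esub> f \<one>\<^bsub>T\<^esub> \<in> ring_center T"
    using h(1) fd(1) by (auto simp: ring_center_def T.l_distr T.r_distr)
  then show "g \<one>\<^bsub>T\<^esub> \<in> ring_center T" using g_eq by simp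
  have "g x = ?d x \<oplus>\<^bsub>T\<^esub> x \<otimes>\<^bsub>T\<^esub> g \<one>\<^bsub>T\<^esub>" if x: "x \<in> carrier T" for x
  proof -
    have "g x = x \<otimes>\<^bsub>T\<^esub> ?h \<one>\<^bsub>T\<^esub> \<oplus>\<^bsub>T\<^esub> f x" using g_eq[OF x] h(2)[OF x] by simp
    \<comment> \<open>As \<open>?h 1 = g 1 - f 1\<close>, the term \<open>x f(1)\<close> moves over
      to \<open>f x\<close> and completes \<open>?d x\<close>.\<close>
    also have "\<dots> = ?d x \<oplus>\<^bsub>T\<^esub> x \<otimes>\<^bsub>T\<^esub> g \<one>\<^bsub>T\<^esub>"
      using x by (intro T.mult_diff_add closed T.one_closed)
    finally show ?thesis .
  qed
  with fd(2) show "\<exists>d. derivation T d \<and> (\<forall>x\<in>carrier T. g x = d x \<oplus>\<^bsub>T\<^esub> x \<otimes>\<^bsub>T\<^esub> g \<one>\<^bsub>T\<^esub>)"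
    by blast
qed

end

section \<open>Equivalence of the four conditions\<close>

theorem theorem4p1:
  fixes R :: "('r, 'x) ring_scheme"
    and M :: "('r, 'm, 's, 'y) bimodule_scheme"
    and S :: "('s, 'z) ring_scheme"
    and T :: "('r \<times> 'm \<times> 's) ring" (structure)
    and \<tau> :: "'r \<times> 'm \<times> 's \<Rightarrow> 'r \<times> 'm \<times> 's"
  assumes "bimodule R M S"
    and "two_torsion_free R" and "two_torsion_free S" and "two_torsion_free M"
    and "left_faithful R M" and "right_faithful M S"
    and "T = Tri R M S"
    and "additive_map T \<tau>"
  shows
    "let
       cond_i =
         (\<exists>d. derivation T d \<and> (\<forall>X\<in>carrier T. \<tau> X = d X \<oplus> X \<otimes> \<tau> \<one>))
         \<and> \<tau> \<one> \<in> ring_center T;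
       cond_ii =
         (\<forall>X\<in>carrier T. \<forall>Y\<in>carrier T. X \<otimes> Y = \<zero> \<and> Y \<otimes> X = \<zero> \<longrightarrow>
           X \<otimes> \<tau> Y \<oplus> \<tau> X \<otimes> Y \<oplus> Y \<otimes> \<tau> X \<oplus> \<tau> Y \<otimes> X = \<zero>);
       cond_iii =
         (\<exists>\<delta>. jordan_derivation T \<delta> \<and>
           (\<forall>X\<in>carrier T. \<forall>Y\<in>carrier T.
             \<tau> (X \<otimes> Y \<oplus> Y \<otimes> X) =
               X \<otimes> \<tau> Y \<oplus> \<delta> X \<otimes> Y \<oplus> \<tau> Y \<otimes> X \<oplus> Y \<otimes> \<delta> X));
       cond_iv =
         (\<exists>\<delta>. additive_map T \<delta> \<and>
           (\<forall>X\<in>carrier T. \<forall>Y\<in>carrier T. X \<otimes> Y = \<zero> \<and> Y \<otimes> X = \<zero> \<longrightarrow>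
             X \<otimes> \<delta> Y \<oplus> \<delta> X \<otimes> Y \<oplus> Y \<otimes> \<delta> X \<oplus> \<delta> Y \<otimes> X = \<zero>) \<and>
           (\<forall>X\<in>carrier T. \<forall>Y\<in>carrier T. X \<otimes> Y = \<zero> \<and> Y \<otimes> X = \<zero> \<longrightarrow>
             X \<otimes> \<tau> Y \<oplus> \<delta> X \<otimes> Y \<oplus> Y \<otimes> \<delta> X \<oplus> \<tau> Y \<otimes> X = \<zero>))
     in (cond_i \<longleftrightarrow> cond_ii) \<and> (cond_i \<longleftrightarrow> cond_iii) \<and> (cond_i \<longleftrightarrow> cond_iv)"
proof -
  interpret faithful_bimodule R M S
    using assms by (simp add: faithful_bimodule_def faithful_bimodule_axioms_def)
  note tor = assms(2,3)
  have add: "additive_map (Tri R M S) \<tau>" using assms(7,8) by simp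
  define gd where "gd \<longleftrightarrow> (\<exists>d. derivation T d \<and> (\<forall>X\<in>carrier T. \<tau> X = d X \<oplus> X \<otimes> \<tau> \<one>))
         \<and> \<tau> \<one> \<in> ring_center T"
  \<comment> \<open>Gives (i) from (iv), and also from (ii) by taking \<delta> to be \<tau>
    itself.\<close>
  have gdI: gd if "additive_map T \<delta>" "zero_product_jordan T \<delta> \<delta>" "zero_product_jordan T \<delta> \<tau>" for \<delta>
    using zero_product_jordan_generalized_derivation[OF tor _ add, of \<delta>] that
    unfolding gd_def assms(7) by blast
  \<comment> \<open>A single witness, the derivation of (i), serves for both (iii) and (iv); the
    conjunct for the pair (\<tau>, \<tau>) is (ii).\<close>
  have gdE: "\<exists>\<delta>. jordan_derivation T \<delta> \<and> additive_map T \<delta> \<and> zero_product_jordan T \<delta> \<delta> \<and>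
      zero_product_jordan T \<delta> \<tau> \<and> zero_product_jordan T \<tau> \<tau> \<and>
      (\<forall>X\<in>carrier T. \<forall>Y\<in>carrier T. \<tau> (X \<otimes> Y \<oplus> Y \<otimes> X) =
               X \<otimes> \<tau> Y \<oplus> \<delta> X \<otimes> Y \<oplus> \<tau> Y \<otimes> X \<oplus> Y \<otimes> \<delta> X)" if gd
  proof -
    from that obtain d where d: "derivation T d" and c: "\<tau> \<one> \<in> ring_center T"
      and t: "\<And>X. X \<in> carrier T \<Longrightarrow> \<tau> X = d X \<oplus> X \<otimes> \<tau> \<one>"
      unfolding gd_def by blast
    interpret T': ring T unfolding assms(7) by (rule Tri_ring)
    have j: "jordan_derivation T d" by (rule T'.derivation_jordan_derivation[OF d])
    have a: "additive_map T d" using d by (simp add: derivation_def)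
    note eq = T'.derivation_plus_central_jordan[OF d c t]
    show ?thesis
      using j a eq T'.jordan_derivation_zero_product_jordan[OF j]
        T'.jordan_generalized_zero_product_jordan[OF a assms(8) eq]
        T'.derivation_plus_central_zero_product_jordan[OF d c assms(8) t]
      by blast
  qed
  \<comment> \<open>Reduces (iii) to the premises of \<open>gdI\<close>, so that (iii) implies (i)
    by way of (iv).\<close>
  have iii: "zero_product_jordan T \<delta> \<delta> \<and> zero_product_jordan T \<delta> \<tau> \<and> additive_map T \<delta>"
    if j: "jordan_derivation T \<delta>"
      and eq: "\<forall>X\<in>carrier T. \<forall>Y\<in>carrier T. \<tau> (X \<otimes> Y \<oplus> Y \<otimes> X) =
               X \<otimes> \<tau> Y \<oplus> \<delta> X \<otimes> Y \<oplus> \<tau> Y \<otimes> X \<oplus> Y \<otimes> \<delta> X" for \<delta>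
  proof -
    interpret T': ring T unfolding assms(7) by (rule Tri_ring)
    have "additive_map T \<delta>" using j by (simp add: jordan_derivation_def)
    then show ?thesis
      using T'.jordan_derivation_zero_product_jordan[OF j]
        T'.jordan_generalized_zero_product_jordan[OF _ assms(8)] eq by simp
  qed
  show ?thesis
    unfolding Let_def gd_def[symmetric] zero_product_jordan_def[symmetric]
    using gdI gdE iii assms(8) by blast
qed

end
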